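(* Let $d\ge 3$ be a prime number. Then for every $m\in\{1,2,3\}$ the $m$-th Misiurewicz polynomial $G_m\in\mathbb{Z}[a]$ (associated with the family of maps $\phi_a(z)=\frac{az}{z^d+(d-1)}$, $a\neq 0$) is irreducible over $\mathbb{Q}$.
   Context: Let $d\ge 2$ be an integer and $a$ an indeterminate. Consider the family of degree $d$ rational maps $\phi_a([x,y])=[axy^{d-1},\,x^d+(d-1)y^d]$ on $\mathbb{P}^1$ ($a\ne 0$). Its iterates evaluated at the critical point $[1,1]$ are $\phi_a^n([1,1])=[p_n,q_n]$, where $p_n,q_n\in\mathbb{Z}[a]$ are defined recursively by $p_0=q_0=1$ and $$p_{n+1}=a\,p_n q_n^{d-1},\qquad q_{n+1}=p_n^d+(d-1)q_n^d\qquad (n\ge 0).$$ For $m\ge 1$, the $m$-th Misiurewicz polynomial is $$G_m = \frac{1}{a-d} \left[ a^d q_{m-1}^{d(d-1)} - (a-d+1)\, \frac{q_m^d - (aq_{m-1}^d)^d}{q_m - aq_{m-1}^d}\right],$$ which is an element of $\mathbb{Z}[a]$; here the inner quotient is the polynomial $\sum_{i=0}^{d-1} q_m^{\,i}\,(aq_{m-1}^d)^{d-1-i}$. *)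

theory Defs
  imports "HOL-Computational_Algebra.Computational_Algebra"
begin

text \<open>
  Integer polynomials are univariate in the parameter; the indeterminate \<open>a\<close> is \<open>[:0, 1:] :: int poly\<close>.
\<close>

abbreviation indet :: "int poly" where
  "indet \<equiv> [:0, 1:]"

text \<open>
  The map \<open>[x, y] \<mapsto> [a x y^(d-1), x^d + (d-1) y^d]\<close> on homogeneous coordinates.
\<close>

definition phi :: "nat \<Rightarrow> int poly \<times> int poly \<Rightarrow> int poly \<times> int poly" where
  "phi d = (\<lambda>(x, y). (indet * x * y ^ (d - 1), x ^ d + (of_nat d - 1) * y ^ d))"

fun orbit_p :: "nat \<Rightarrow> nat \<Rightarrow> int poly"
and orbit_q :: "nat \<Rightarrow> nat \<Rightarrow> int poly" where
  "orbit_p d 0 = 1"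
| "orbit_q d 0 = 1"
| "orbit_p d (Suc n) = indet * orbit_p d n * orbit_q d n ^ (d - 1)"
| "orbit_q d (Suc n) = orbit_p d n ^ d + (of_nat d - 1) * orbit_q d n ^ d"

lemma funpow_phi: "(phi d ^^ n) (1, 1) = (orbit_p d n, orbit_q d n)"
  by (induction n) (simp_all add: phi_def)

text \<open>
  The polynomial \<open>(u ^ d - v ^ d) / (u - v)\<close> with \<open>u = orbit_q d m\<close> and
  \<open>v = a * orbit_q d (m - 1) ^ d\<close>; see \<open>inner_quotient_eq_div\<close> below.
\<close>

definition inner_quotient :: "nat \<Rightarrow> nat \<Rightarrow> int poly" where
  "inner_quotient d m =
     (\<Sum>i = 0..d - 1. orbit_q d m ^ i * (indet * orbit_q d (m - 1) ^ d) ^ (d - 1 - i))"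

definition misiurewicz_numerator :: "nat \<Rightarrow> nat \<Rightarrow> int poly" where
  "misiurewicz_numerator d m =
     indet ^ d * orbit_q d (m - 1) ^ (d * (d - 1))
       - (indet - of_nat d + 1) * inner_quotient d m"

text \<open>
  Division of integer polynomials; it is exact for \<open>d \<ge> 1\<close> and \<open>m \<ge> 1\<close>,
  see \<open>misiurewicz_mult\<close> below. The value at \<open>m = 0\<close> is meaningless.
\<close>

definition misiurewicz :: "nat \<Rightarrow> nat \<Rightarrow> int poly" where
  "misiurewicz d m = misiurewicz_numerator d m div (indet - of_nat d)"

lemma inner_quotient_mult:
  assumes "d \<ge> 1"
  shows "(orbit_q d m - indet * orbit_q d (m - 1) ^ d) * inner_quotient d m
           = orbit_q d m ^ d - (indet * orbit_q d (m - 1) ^ d) ^ d"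
proof -
  obtain k where k: "d = Suc k"
    using assms by (cases d) auto
  have "inner_quotient d m
          = (\<Sum>i<Suc k. (indet * orbit_q d (m - 1) ^ d) ^ (Suc k - Suc i) * orbit_q d m ^ i)"
    unfolding inner_quotient_def by (rule sum.cong) (use k in \<open>auto simp: mult.commute\<close>)
  then show ?thesis
    using power_diff_sumr2[of "orbit_q d m" "Suc k" "indet * orbit_q d (m - 1) ^ d"] k by simp
qed

lemma poly_of_nat_int: "poly (of_nat n) x = (of_nat n :: int)"
  by (induction n) auto

lemma poly_orbit_at_0:
  assumes "d \<ge> 2"
  shows "poly (orbit_p d (Suc n)) 0 = 0" "poly (orbit_q d (Suc n)) 0 \<noteq> 0"
proof -
  show "poly (orbit_p d (Suc n)) 0 = 0" by simp
  show "poly (orbit_q d (Suc n)) 0 \<noteq> 0"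
  proof (induction n)
    case 0
    then show ?case using assms by (simp add: poly_of_nat_int)
  next
    case (Suc n)
    have "poly (orbit_p d (Suc n)) 0 = 0" by simp
    then have "poly (orbit_q d (Suc (Suc n))) 0
            = (int d - 1) * poly (orbit_q d (Suc n)) 0 ^ d"
      unfolding orbit_q.simps(2)[of d "Suc n"] poly_add poly_mult poly_diff poly_power
      using assms by (simp only: poly_of_nat_int poly_1 power_0_left) simp
    then show ?case using Suc assms by (simp del: orbit_q.simps)
  qed
qed

lemma inner_quotient_eq_div:
  assumes "d \<ge> 2" "m \<ge> 1"
  shows "inner_quotient d m =
           (orbit_q d m ^ d - (indet * orbit_q d (m - 1) ^ d) ^ d)
             div (orbit_q d m - indet * orbit_q d (m - 1) ^ d)"
proof -
  let ?D = "orbit_q d m - indet * orbit_q d (m - 1) ^ d"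
  have "poly ?D 0 \<noteq> 0"
    using poly_orbit_at_0(2)[of d "m - 1"] assms by simp
  then have "?D \<noteq> 0" by (intro notI) (simp only: poly_0)
  moreover have "?D * inner_quotient d m
      = orbit_q d m ^ d - (indet * orbit_q d (m - 1) ^ d) ^ d"
    by (rule inner_quotient_mult) (use assms in linarith)
  ultimately show ?thesis
    by (metis nonzero_mult_div_cancel_left)
qed

lemma poly_orbit_at_d:
  assumes "d \<ge> 1"
  shows "poly (orbit_p d n) (int d) = poly (orbit_q d n) (int d)"
proof (induction n)
  case (Suc n)
  let ?y = "poly (orbit_q d n) (int d)"
  have "?y ^ d = ?y * ?y ^ (d - 1)"
    using assms by (metis Suc_diff_le diff_Suc_1 One_nat_def power_Suc)
  with Suc show ?case by (simp add: poly_of_nat_int algebra_simps)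
qed simp

lemma poly_misiurewicz_numerator_at_d:
  assumes "d \<ge> 1" "m \<ge> 1"
  shows "poly (misiurewicz_numerator d m) (int d) = 0"
proof -
  obtain n where m: "m = Suc n" using assms(2) by (cases m) auto
  obtain k where k: "d = Suc k" using assms(1) by (cases d) auto
  let ?y = "poly (orbit_q d n) (int d)"
  let ?z = "int d * ?y ^ d"
  have q: "poly (orbit_q d m) (int d) = ?z"
    using poly_orbit_at_d[OF assms(1), of n]
    by (simp add: m poly_of_nat_int algebra_simps)
  have "poly (inner_quotient d m) (int d) = (\<Sum>i = 0..k. ?z ^ i * ?z ^ (k - i))"
    unfolding inner_quotient_def poly_sum
    by (rule sum.cong) (use q m k in simp_all)
  also have "\<dots> = (\<Sum>i = 0..k. ?z ^ k)"
    by (rule sum.cong) (simp_all flip: power_add)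
  also have "\<dots> = int d * ?z ^ k" by (simp add: k)
  finally have S: "poly (inner_quotient d m) (int d) = int d * ?z ^ k" .
  have "int d * ?z ^ k = int d ^ d * ?y ^ (d * (d - 1))"
    by (simp add: k power_mult_distrib power_mult[symmetric] del: power_Suc)
       (simp add: mult.assoc)
  then show ?thesis
    unfolding misiurewicz_numerator_def
    using S by (simp add: poly_of_nat_int m)
qed

lemma misiurewicz_mult:
  assumes "d \<ge> 1" "m \<ge> 1"
  shows "(indet - of_nat d) * misiurewicz d m = misiurewicz_numerator d m"
proof -
  have "indet - of_nat d = [:- int d, 1:]"
    by (simp add: of_nat_poly)
  then have "indet - of_nat d dvd misiurewicz_numerator d m"
    using poly_misiurewicz_numerator_at_d[OF assms] by (simp add: poly_eq_0_iff_dvd)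
  then show ?thesis unfolding misiurewicz_def by simp
qed

end

theory Submission
  imports Defs
begin

text \<open>
  Put \<open>t = a - d\<close> and \<open>\<delta>\<^sub>m = p\<^sub>m\<^sup>d - (1 + t) q\<^sub>m\<^sup>d\<close>. Then \<open>q\<^sub>m\<^sub>+\<^sub>1 = a q\<^sub>m\<^sup>d + \<delta>\<^sub>m\<close>, hence \<open>\<delta>\<^sub>m\<^sub>+\<^sub>1 = t G\<^sub>m\<^sub>+\<^sub>1 \<delta>\<^sub>m\<close>, and
  the binomial theorem expresses \<open>t G\<^sub>m\<^sub>+\<^sub>1\<close> through \<open>q\<^sub>m\<close> and \<open>\<delta>\<^sub>m\<close>. After substituting \<open>a = d (1 + c)\<close> and removing
  powers of \<open>d\<close>, this recursion shows that the \<open>d\<close>-adic Newton polygon of \<open>G\<^sub>m\<close> in \<open>c\<close> contains the edge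
  from \<open>(0, e)\<close> to \<open>(n, 0)\<close> with \<open>e = d\<^sup>m\<^sup>-\<^sup>1\<close> and \<open>n = d\<^sup>m - d\<^sup>m\<^sup>-\<^sup>1 - 1\<close>. As \<open>e\<close> and \<open>n\<close> are coprime, Dumas' argument
  gives a factor of degree at least \<open>n\<close>. For \<open>m = 1\<close> and \<open>m = 3\<close> this is the full degree. For \<open>m = 2\<close> the degree is
  \<open>n + 1\<close>, and a rational root would be an integer, which is excluded by divisibility and size.
\<close>

subsection \<open>Newton polygons and Dumas' criterion\<close>

text \<open>
  For \<open>n > 0\<close>: every nonzero coefficient \<open>f\<^sub>j\<close> satisfies \<open>n \<cdot> v\<^sub>p(f\<^sub>j) + e \<cdot> j \<ge> s\<close>. The existential over \<open>k\<close>
  avoids \<open>multiplicity p 0 = 0\<close>.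
\<close>

definition newton_ge :: "int \<Rightarrow> nat \<Rightarrow> nat \<Rightarrow> nat \<Rightarrow> int poly \<Rightarrow> bool" where
  "newton_ge p n e s f \<longleftrightarrow> (\<forall>j. \<exists>k. s \<le> n * k + e * j \<and> p ^ k dvd coeff f j)"

lemma newton_ge_mono:
  assumes "newton_ge p n e s f" "t \<le> s"
  shows "newton_ge p n e t f"
  using assms unfolding newton_ge_def by (meson le_trans)

lemma newton_ge_0: "newton_ge p n e 0 f"
  unfolding newton_ge_def by (intro allI exI[of _ 0]) auto

lemma newton_ge_add:
  assumes "newton_ge p n e s f" "newton_ge p n e s g"
  shows "newton_ge p n e s (f + g)"
  unfolding newton_ge_def
proof
  fix j
  obtain k l where k: "s \<le> n * k + e * j" "p ^ k dvd coeff f j"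
    and l: "s \<le> n * l + e * j" "p ^ l dvd coeff g j"
    using assms unfolding newton_ge_def by blast
  have "p ^ min k l dvd coeff f j" "p ^ min k l dvd coeff g j"
    using k(2) l(2) by (meson dvd_trans le_imp_power_dvd min.cobounded1 min.cobounded2)+
  then have "p ^ min k l dvd coeff (f + g) j" by simp
  moreover have "s \<le> n * min k l + e * j" using k(1) l(1) by (simp add: min_def)
  ultimately show "\<exists>k. s \<le> n * k + e * j \<and> p ^ k dvd coeff (f + g) j" by blast
qed

lemma newton_ge_uminus: "newton_ge p n e s f \<Longrightarrow> newton_ge p n e s (- f)"
  unfolding newton_ge_def by simp

lemma newton_ge_diff:
  assumes "newton_ge p n e s f" "newton_ge p n e s g"
  shows "newton_ge p n e s (f - g)"
  using newton_ge_add[OF assms(1) newton_ge_uminus[OF assms(2)]] by simp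

lemma newton_ge_zero:
  assumes "n > 0"
  shows "newton_ge p n e s 0"
  unfolding newton_ge_def using assms by (intro allI exI[of _ s]) (simp add: trans_le_add1)

lemma newton_ge_sum:
  assumes "n > 0" "\<And>i. i \<in> I \<Longrightarrow> newton_ge p n e s (f i)"
  shows "newton_ge p n e s (sum f I)"
  using assms by (induction I rule: infinite_finite_induct) (auto intro: newton_ge_zero newton_ge_add)

lemma newton_ge_mult:
  assumes "n > 0" "newton_ge p n e s f" "newton_ge p n e t g"
  shows "newton_ge p n e (s + t) (f * g)"
  unfolding newton_ge_def
proof
  fix j
  have "\<exists>k. s + t \<le> n * k + e * j \<and> p ^ k dvd coeff f i * coeff g (j - i)" if "i \<le> j" for i
  proof -
    obtain k l where k: "s \<le> n * k + e * i" "p ^ k dvd coeff f i"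
      and l: "t \<le> n * l + e * (j - i)" "p ^ l dvd coeff g (j - i)"
      using assms unfolding newton_ge_def by blast
    have "e * i + e * (j - i) = e * j" using that by (simp flip: distrib_left)
    then have "s + t \<le> n * (k + l) + e * j" using k(1) l(1) by (simp add: distrib_left)
    moreover have "p ^ (k + l) dvd coeff f i * coeff g (j - i)"
      using k(2) l(2) by (simp add: power_add mult_dvd_mono)
    ultimately show ?thesis by blast
  qed
  then obtain k where k: "\<And>i. i \<le> j \<Longrightarrow> s + t \<le> n * k i + e * j"
    "\<And>i. i \<le> j \<Longrightarrow> p ^ k i dvd coeff f i * coeff g (j - i)"
    by metis
  \<comment> \<open>Each product has its own exponent. The smallest one divides the whole
    convolution sum and, being one of them, still meets the weight bound.\<close>
  define l where "l = Min (k ` {..j})"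
  have "l \<in> k ` {..j}" unfolding l_def by (rule Min_in) auto
  then have "s + t \<le> n * l + e * j" using k(1) by auto
  moreover have "p ^ l dvd coeff f i * coeff g (j - i)" if "i \<le> j" for i
  proof -
    have "l \<le> k i" unfolding l_def using that by (intro Min_le) auto
    then show ?thesis using k(2)[OF that] by (meson dvd_trans le_imp_power_dvd)
  qed
  then have "p ^ l dvd coeff (f * g) j"
    unfolding coeff_mult by (intro dvd_sum) auto
  ultimately show "\<exists>k. s + t \<le> n * k + e * j \<and> p ^ k dvd coeff (f * g) j" by blast
qed

lemma newton_ge_power:
  assumes "n > 0" "newton_ge p n e s f"
  shows "newton_ge p n e (k * s) (f ^ k)"
  by (induction k) (use newton_ge_mult[OF assms(1) assms(2)] in \<open>auto simp: newton_ge_0\<close>)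

text \<open>The weight is normalised so that a factor \<open>p\<close> contributes \<open>n\<close>
  and a factor \<open>X\<close> contributes \<open>e\<close>.\<close>

lemma newton_ge_dvd_const:
  assumes "p dvd c"
  shows "newton_ge p n e n [:c:]"
  unfolding newton_ge_def
  using assms by (intro allI exI[of _ 1]) (auto simp: coeff_pCons split: nat.split)

lemma newton_ge_X:
  assumes "n > 0"
  shows "newton_ge p n e e [:0, 1:]"
  unfolding newton_ge_def
proof
  fix j
  show "\<exists>k. e \<le> n * k + e * j \<and> p ^ k dvd coeff [:0, 1:] j"
  proof (cases j)
    case 0
    then show ?thesis using assms by (intro exI[of _ e]) auto
  next
    case (Suc i)
    then show ?thesis by (intro exI[of _ 0]) auto
  qed
qed

text \<open>Dividing by \<open>X\<close> moves index \<open>Suc j\<close> to \<open>j\<close>, which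
  costs exactly \<open>e\<close>.\<close>

lemma newton_ge_divide_X:
  assumes "newton_ge p n e (s + e) ([:0, 1:] * f)"
  shows "newton_ge p n e s f"
  unfolding newton_ge_def
proof
  fix j
  obtain k where "s + e \<le> n * k + e * Suc j" "p ^ k dvd coeff ([:0, 1:] * f) (Suc j)"
    using assms unfolding newton_ge_def by blast
  then show "\<exists>k. s \<le> n * k + e * j \<and> p ^ k dvd coeff f j"
    by (intro exI[of _ k]) auto
qed

text \<open>Among the indices of minimal weight the first is chosen, as in Gauss' lemma: for two
  polynomials the chosen terms then meet in a coefficient of the product where all other
  contributions are strictly heavier.\<close>

lemma exists_lowest_weight:
  fixes g :: "int poly" and w :: "nat \<Rightarrow> nat"
  assumes "g \<noteq> 0"
  obtains i where "coeff g i \<noteq> 0"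
    "\<And>j. coeff g j \<noteq> 0 \<Longrightarrow> w i \<le> w j"
    "\<And>j. coeff g j \<noteq> 0 \<Longrightarrow> j < i \<Longrightarrow> w i < w j"
proof -
  define P where "P s \<longleftrightarrow> (\<exists>j. coeff g j \<noteq> 0 \<and> w j = s)" for s
  define s where "s = (LEAST s. P s)"
  define R where "R j \<longleftrightarrow> coeff g j \<noteq> 0 \<and> w j = s" for j
  define i where "i = (LEAST j. R j)"
  have "P (w (degree g))" unfolding P_def using assms leading_coeff_neq_0 by blast
  then have "P s" unfolding s_def by (rule LeastI)
  then have "\<exists>j. R j" unfolding P_def R_def .
  then have "R i" unfolding i_def by (metis LeastI)
  have s_le: "s \<le> w j" if "coeff g j \<noteq> 0" for j
    unfolding s_def by (rule Least_le) (use that P_def in auto)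
  show ?thesis
  proof (rule that[of i])
    show "coeff g i \<noteq> 0" "\<And>j. coeff g j \<noteq> 0 \<Longrightarrow> w i \<le> w j"
      using \<open>R i\<close> s_le by (auto simp: R_def)
    show "w i < w j" if "coeff g j \<noteq> 0" "j < i" for j
      using s_le[OF that(1)] not_less_Least[of j R] that \<open>R i\<close>
      by (auto simp: R_def i_def order_le_less)
  qed
qed

text \<open>
  Dumas: \<open>F\<close> has a Newton polygon edge from \<open>(0, e)\<close> to \<open>(n, 0)\<close>. Coefficients beyond \<open>n\<close> are allowed,
  and \<open>D\<close> makes the statement applicable to rational factorizations. The minimal weights of \<open>g\<close> and \<open>h\<close>
  are attained at their constant terms, and at no positive index below \<open>n\<close> by coprimality; if both
  degrees were below \<open>n\<close>, the \<open>n\<close>-th coefficient of \<open>g * h\<close> would be too divisible.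
\<close>

lemma dumas_degree:
  fixes F g h :: "int poly" and p D :: int
  assumes p: "prime p" and "n > 0" and "coprime e n" and D: "D \<noteq> 0"
    and gh: "smult D F = g * h"
    and ge: "newton_ge p n e (n * e) F"
    and Fn: "\<not> p dvd coeff F n"
    and F0: "coeff F 0 \<noteq> 0" "multiplicity p (coeff F 0) = e"
  shows "n \<le> degree g \<or> n \<le> degree h"
proof (rule ccontr)
  assume "\<not> ?thesis"
  then have deg: "degree g < n" "degree h < n" by auto
  define v where "v = multiplicity p"
  define S where "S = n * v D + n * e"
  have v_mult: "v (x * y) = v x + v y" if "x \<noteq> 0" "y \<noteq> 0" for x y
    unfolding v_def using p that by (intro prime_elem_multiplicity_mult_distrib) auto
  have dvd_iff: "p ^ k dvd x \<longleftrightarrow> k \<le> v x" if "x \<noteq> 0" for k x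
    unfolding v_def using p that by (meson power_dvd_iff_le_multiplicity not_prime_unit)
  define w where "w f j = n * v (coeff f j) + e * j" for f :: "int poly" and j
  have w_mult: "n * v (coeff f i * coeff f' j) + e * (i + j) = w f i + w f' j"
    if "coeff f i \<noteq> 0" "coeff f' j \<noteq> 0" for f f' i j
    using v_mult[OF that] by (simp add: w_def algebra_simps)
  have S_le: "S \<le> w (g * h) j" if "coeff (g * h) j \<noteq> 0" for j
  proof -
    have c: "coeff (g * h) j = D * coeff F j" by (simp flip: gh)
    then have nz: "coeff F j \<noteq> 0" using that by auto
    obtain k where k: "n * e \<le> n * k + e * j" "p ^ k dvd coeff F j"
      using ge unfolding newton_ge_def by blast
    then have "n * k \<le> n * v (coeff F j)" using dvd_iff[OF nz] by (intro mult_le_mono2) simp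
    with k(1) have "n * e \<le> n * v (coeff F j) + e * j" by linarith
    then show ?thesis unfolding w_def S_def c v_mult[OF D nz] by (simp add: distrib_left)
  qed
  have c0: "coeff g 0 * coeff h 0 = D * coeff F 0"
    using arg_cong[OF gh, of "\<lambda>f. coeff f 0"] by (simp add: coeff_mult)
  then have g0: "coeff g 0 \<noteq> 0" and h0: "coeff h 0 \<noteq> 0" using F0 D by auto
  then have "g \<noteq> 0" "h \<noteq> 0" by auto
  have w0: "w g 0 + w h 0 = S"
    using w_mult[OF g0 h0] c0 v_mult[OF D F0(1)] F0(2) by (simp add: S_def v_def distrib_left)
  obtain i where i: "coeff g i \<noteq> 0" "\<And>j. coeff g j \<noteq> 0 \<Longrightarrow> w g i \<le> w g j"
    "\<And>j. coeff g j \<noteq> 0 \<Longrightarrow> j < i \<Longrightarrow> w g i < w g j"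
    using exists_lowest_weight[OF \<open>g \<noteq> 0\<close>, of "w g"] by blast
  obtain l where l: "coeff h l \<noteq> 0" "\<And>j. coeff h j \<noteq> 0 \<Longrightarrow> w h l \<le> w h j"
    "\<And>j. coeff h j \<noteq> 0 \<Longrightarrow> j < l \<Longrightarrow> w h l < w h j"
    using exists_lowest_weight[OF \<open>h \<noteq> 0\<close>, of "w h"] by blast
  let ?k = "v (coeff g i * coeff h l)"
  \<comment> \<open>Any other pair with index sum \<open>i + l\<close> has a smaller index on one
    side, where minimality is strict. Equal index sums let the \<open>e\<close> parts cancel, so
    heavier means more divisible by \<open>p\<close>.\<close>
  have other: "p ^ Suc ?k dvd coeff g j * coeff h (i + l - j)" if "j \<le> i + l" "j \<noteq> i" for j
  proof (cases "coeff g j * coeff h (i + l - j) = 0")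
    case False
    then have nz: "coeff g j \<noteq> 0" "coeff h (i + l - j) \<noteq> 0" by auto
    have "w g i + w h l < w g j + w h (i + l - j)"
    proof (cases "j < i")
      case True
      then show ?thesis using i(3)[OF nz(1)] l(2)[OF nz(2)] by linarith
    next
      case False
      then have "i + l - j < l" using that by linarith
      then show ?thesis using i(2)[OF nz(1)] l(3)[OF nz(2)] by linarith
    qed
    then have "n * ?k < n * v (coeff g j * coeff h (i + l - j))"
      unfolding w_mult[OF i(1) l(1), symmetric] w_mult[OF nz, symmetric]
        le_add_diff_inverse[OF that(1)] by (simp only: add_less_cancel_right)
    then show ?thesis using dvd_iff[OF False] by (simp del: power_Suc)
  next
    case True
    then show ?thesis by (simp only: dvd_0_right)
  qed
  have split: "coeff (g * h) (i + l) = coeff g i * coeff h l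
      + (\<Sum>j\<in>{..i + l} - {i}. coeff g j * coeff h (i + l - j))"
    unfolding coeff_mult by (subst sum.remove[of _ i]) auto
  have "p ^ Suc ?k dvd (\<Sum>j\<in>{..i + l} - {i}. coeff g j * coeff h (i + l - j))"
    using other by (intro dvd_sum) auto
  moreover have "\<not> p ^ Suc ?k dvd coeff g i * coeff h l"
    using dvd_iff[of "coeff g i * coeff h l" "Suc ?k"] i(1) l(1) by simp
  ultimately have nd: "\<not> p ^ Suc ?k dvd coeff (g * h) (i + l)"
    unfolding split by (simp only: dvd_add_left_iff not_False_eq_True)
  then have nz: "coeff (g * h) (i + l) \<noteq> 0" by (metis dvd_0_right)
  have "v (coeff (g * h) (i + l)) \<le> ?k"
    using nd unfolding dvd_iff[OF nz] by linarith
  then have "w (g * h) (i + l) \<le> w g i + w h l"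
    unfolding w_mult[OF i(1) l(1), symmetric] w_def[of "g * h"]
    by (intro add_right_mono mult_le_mono2)
  \<comment> \<open>The minimal weights add up to at least \<open>S\<close>, and the weights of the
    constant terms add up to exactly \<open>S\<close>; hence the constant terms are minimal
    too.\<close>
  with S_le[OF nz] have "S \<le> w g i + w h l" by linarith
  then have min: "w g i = w g 0" "w h l = w h 0"
    using i(2)[OF g0] l(2)[OF h0] w0 by linarith+
  have strict: "w f 0 < w f j"
    if "w f 0 \<le> w f j" "coeff f j \<noteq> 0" "j > 0" "degree f < n" for f j
  proof -
    have "w f 0 \<noteq> w f j"
    proof
      assume "w f 0 = w f j"
      then have eq: "n * v (coeff f 0) = n * v (coeff f j) + e * j" by (simp add: w_def)
      have "n dvd e * j"
        using dvd_add_right_iff[of n "n * v (coeff f j)" "e * j"] unfolding eq[symmetric] by simp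
      then have "n dvd j" using \<open>coprime e n\<close>
        by (simp add: coprime_commute coprime_dvd_mult_right_iff)
      moreover have "j \<le> degree f" using that(2) by (rule le_degree)
      ultimately show False using that(3,4) by (meson dvd_imp_le leD le_less_trans)
    qed
    with that(1) show ?thesis by simp
  qed
  have "p ^ Suc (v D) dvd coeff g j * coeff h (n - j)" if "j \<le> n" for j
  proof (cases "coeff g j * coeff h (n - j) = 0")
    case False
    then have nz: "coeff g j \<noteq> 0" "coeff h (n - j) \<noteq> 0" by auto
    have le: "w g 0 \<le> w g j" "w h 0 \<le> w h (n - j)"
      using min i(2)[OF nz(1)] l(2)[OF nz(2)] by simp_all
    have "w g 0 + w h 0 < w g j + w h (n - j)"
    proof (cases "j > 0")
      case True
      then show ?thesis using strict[OF le(1) nz(1) _ deg(1)] le(2) by linarith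
    next
      case False
      then have "n - j > 0" using \<open>n > 0\<close> by simp
      then show ?thesis using strict[OF le(2) nz(2) _ deg(2)] le(1) by linarith
    qed
    \<comment> \<open>At index \<open>n\<close> a weight above \<open>S = n * v D + n * e\<close>
      means a valuation above \<open>v D\<close>.\<close>
    then have "n * v D < n * v (coeff g j * coeff h (n - j))"
      unfolding w0 w_mult[OF nz, symmetric] le_add_diff_inverse[OF that] S_def
      by (simp only: mult.commute[of e n] add_less_cancel_right)
    then show ?thesis using dvd_iff[OF False] by (simp del: power_Suc)
  next
    case True
    then show ?thesis by (simp only: dvd_0_right)
  qed
  then have "p ^ Suc (v D) dvd coeff (g * h) n"
    unfolding coeff_mult by (intro dvd_sum) auto
  also have "coeff (g * h) n = D * coeff F n" by (simp flip: gh)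
  finally have dvd: "p ^ Suc (v D) dvd D * coeff F n" .
  have nz: "coeff F n \<noteq> 0" using Fn by auto
  have "v (coeff F n) = 0" unfolding v_def using Fn by (rule not_dvd_imp_multiplicity_0)
  then have "v (D * coeff F n) = v D" using v_mult[OF D nz] by simp
  then show False using dvd dvd_iff[of "D * coeff F n" "Suc (v D)"] D nz by simp
qed

section \<open>Passing from rational to integer factors\<close>

lemma pcompose_power: "pcompose (p ^ n) r = pcompose p r ^ n"
  for p :: "'a :: comm_semiring_1 poly"
  by (induction n) (simp_all add: pcompose_1 pcompose_mult)

lemma map_poly_of_int_mult:
  "map_poly (of_int :: int \<Rightarrow> rat) (f * g) = map_poly of_int f * map_poly of_int g"
  by (rule poly_eqI) (simp add: coeff_map_poly coeff_mult)

lemma map_poly_of_int_eq_iff: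
  "map_poly (of_int :: int \<Rightarrow> rat) f = map_poly of_int g \<longleftrightarrow> f = g"
  by (auto simp: poly_eq_iff coeff_map_poly)

lemma degree_map_poly_of_int [simp]: "degree (map_poly (of_int :: int \<Rightarrow> rat) f) = degree f"
  by (rule degree_map_poly) auto

lemma clear_denominators:
  fixes f :: "rat poly"
  obtains D g where "D \<noteq> 0" "smult (of_int D) f = map_poly of_int g"
proof -
  have "\<exists>D g. D \<noteq> (0 :: int) \<and> smult (of_int D) f = map_poly of_int g"
  proof (induction f)
    case 0
    show ?case by (intro exI[of _ 1] exI[of _ 0]) auto
  next
    case (pCons a f)
    then obtain D g where D: "D \<noteq> (0 :: int)" "smult (of_int D) f = map_poly of_int g" by blast
    obtain x y where a: "a = of_int x / of_int y" "y > 0"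
      by (metis quotient_of_div quotient_of_denom_pos surj_pair)
    have "smult (of_int (D * y)) (pCons a f) = map_poly of_int (pCons (D * x) (smult y g))"
      using a(2) by (auto simp: a(1) map_poly_pCons map_poly_smult D(2)[symmetric] mult.commute)
    then show ?case using D(1) a(2) by (intro exI[of _ "D * y"] exI) auto
  qed
  then show ?thesis using that by blast
qed

text \<open>Clearing denominators and an affine substitution both preserve the degrees of the
  factors. All constants that arise are collected in the scalar that \<open>dumas_degree\<close>
  allows.\<close>

lemma degree_factor_ge:
  fixes G F :: "int poly" and g h :: "rat poly" and p \<alpha> \<beta> b :: int
  assumes p: "prime p" and "n > 0" and "coprime e n" and nz: "\<alpha> \<noteq> 0" "\<beta> \<noteq> 0" "b \<noteq> 0"
    and GF: "smult \<alpha> (pcompose G [:c, b:]) = smult \<beta> F"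
    and ge: "newton_ge p n e (n * e) F"
    and Fn: "\<not> p dvd coeff F n"
    and F0: "coeff F 0 \<noteq> 0" "multiplicity p (coeff F 0) = e"
    and gh: "map_poly of_int G = g * h"
  shows "n \<le> degree g \<or> n \<le> degree h"
proof -
  obtain D g' where g': "D \<noteq> 0" "smult (of_int D) g = map_poly of_int g'"
    using clear_denominators by blast
  obtain E h' where h': "E \<noteq> 0" "smult (of_int E) h = map_poly of_int h'"
    using clear_denominators by blast
  have "map_poly (of_int :: int \<Rightarrow> rat) (smult (D * E) G) = smult (of_int D) g * smult (of_int E) h"
    by (simp add: map_poly_smult gh mult.commute)
  also have "\<dots> = map_poly of_int (g' * h')" by (simp add: g' h' map_poly_of_int_mult)
  finally have "smult (D * E) G = g' * h'" by (simp only: map_poly_of_int_eq_iff)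
  then have "smult (D * E * \<alpha>) (pcompose G [:c, b:])
      = smult \<alpha> (pcompose g' [:c, b:]) * pcompose h' [:c, b:]"
    by (metis pcompose_smult pcompose_mult smult_smult mult.commute mult_smult_left)
  then have "smult (D * E * \<beta>) F = smult \<alpha> (pcompose g' [:c, b:]) * pcompose h' [:c, b:]"
    by (metis GF smult_smult)
  then have "n \<le> degree (smult \<alpha> (pcompose g' [:c, b:])) \<or> n \<le> degree (pcompose h' [:c, b:])"
    using g'(1) h'(1) nz by (intro dumas_degree[OF p \<open>n > 0\<close> \<open>coprime e n\<close> _ _ ge Fn F0]) auto
  moreover have "degree g' = degree g" "degree h' = degree h"
    using g' h' by (metis degree_map_poly_of_int degree_smult_eq of_int_eq_0_iff)+
  ultimately show ?thesis using nz by (simp add: degree_pcompose)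
qed

subsection \<open>The recursion for the Misiurewicz polynomials\<close>

text \<open>
  The nonzero fixed points of the map are the solutions of \<open>z\<^sup>d = a - d + 1\<close>, so \<open>delta d m\<close> vanishes when the
  \<open>m\<close>-th iterate of the critical point is one of them.
\<close>

definition delta :: "nat \<Rightarrow> nat \<Rightarrow> int poly" where
  "delta d m = orbit_p d m ^ d - (indet - of_nat d + 1) * orbit_q d m ^ d"

lemma orbit_q_Suc_delta: "orbit_q d (Suc m) = indet * orbit_q d m ^ d + delta d m"
  unfolding delta_def orbit_q.simps(2) by (simp only: algebra_simps)

text \<open>Since \<open>delta d m\<close> is the denominator of the inner quotient, multiplying the
  numerator of G by it leaves a difference of \<open>d\<close>-th powers. The terms with
  \<open>a ^ d\<close> then combine to \<open>orbit_p d (Suc m) ^ d\<close>.\<close>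

lemma delta_Suc:
  assumes "d \<ge> 1"
  shows "delta d (Suc m) = (indet - of_nat d) * misiurewicz d (Suc m) * delta d m"
proof -
  \<comment> \<open>Here \<open>t\<close> is a - d + 1, one more than the \<open>t\<close> of
    \<open>next_factor\<close>.\<close>
  define q \<delta> t where "q = orbit_q d m" "\<delta> = delta d m" and t: "t = indet - of_nat d + 1"
  note defs = this
  have "misiurewicz_numerator d (Suc m) * \<delta>
      = indet ^ d * q ^ (d * (d - 1)) * \<delta> - t * ((orbit_q d (Suc m) - indet * q ^ d) * inner_quotient d (Suc m))"
    unfolding misiurewicz_numerator_def orbit_q_Suc_delta diff_Suc_1 defs by (simp only: algebra_simps)
  also have "(orbit_q d (Suc m) - indet * q ^ d) * inner_quotient d (Suc m)
      = orbit_q d (Suc m) ^ d - (indet * q ^ d) ^ d"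
    unfolding defs using inner_quotient_mult[OF assms, of "Suc m"] by (simp only: diff_Suc_1)
  also have "(indet * q ^ d) ^ d = indet ^ d * q ^ (d * (d - 1)) * q ^ d"
  proof -
    have dd: "d * d = d * (d - 1) + d" using assms by (cases d) auto
    show ?thesis
      unfolding power_mult_distrib power_mult[symmetric] mult.assoc power_add[symmetric]
      by (simp only: dd[symmetric])
  qed
  also have "indet ^ d * q ^ (d * (d - 1)) * \<delta> - t * (orbit_q d (Suc m) ^ d - indet ^ d * q ^ (d * (d - 1)) * q ^ d)
      = indet ^ d * q ^ (d * (d - 1)) * (\<delta> + t * q ^ d) - t * orbit_q d (Suc m) ^ d"
    by (simp only: algebra_simps)
  also have "\<delta> + t * q ^ d = orbit_p d m ^ d" unfolding defs delta_def by simp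
  also have "indet ^ d * q ^ (d * (d - 1)) * orbit_p d m ^ d = orbit_p d (Suc m) ^ d"
    unfolding orbit_p.simps(2) defs by (simp only: power_mult_distrib power_mult[symmetric] ac_simps)
  finally show ?thesis
    using misiurewicz_mult[OF assms, of "Suc m"] by (simp add: delta_def defs)
qed

text \<open>For t = a - d, q = \<open>orbit_q d m\<close> and \<delta> = \<open>delta d m\<close>
  this is (a - d) times the Misiurewicz polynomial of index m + 1, ordered by powers of \<delta>.
  The explicit arguments let substitution and rescaling act on them.\<close>

definition next_factor :: "nat \<Rightarrow> 'a :: comm_ring_1 \<Rightarrow> 'a \<Rightarrow> 'a \<Rightarrow> 'a \<Rightarrow> 'a" where
  "next_factor d t a q \<delta> = - (of_nat (d - 1) * t * a ^ (d - 1) * q ^ (d * (d - 1)))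
     - (1 + t) * (\<Sum>k = 2..d. of_nat (d choose k) * \<delta> ^ (k - 1) * (a * q ^ d) ^ (d - k))"

text \<open>One factor \<delta> is split off for later cancellation. The term k = 1 stands apart
  because it retains no \<delta>.\<close>

lemma power_add_diff_eq:
  fixes v \<delta> :: "'a :: comm_ring_1"
  assumes "d \<ge> 1"
  shows "(v + \<delta>) ^ d - v ^ d = (of_nat d * v ^ (d - 1)
           + (\<Sum>k = 2..d. of_nat (d choose k) * \<delta> ^ (k - 1) * v ^ (d - k))) * \<delta>"
proof -
  have "(v + \<delta>) ^ d = (\<delta> + v) ^ d" by (simp add: add.commute)
  also have "\<dots> = (\<Sum>k\<le>d. of_nat (d choose k) * \<delta> ^ k * v ^ (d - k))" by (rule binomial_ring)
  also have "{..d} = insert 0 (insert 1 {2..d})" using assms by auto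
  also have "(\<Sum>k\<in>\<dots>. of_nat (d choose k) * \<delta> ^ k * v ^ (d - k))
      = v ^ d + (of_nat d * \<delta> * v ^ (d - 1)
           + (\<Sum>k = 2..d. of_nat (d choose k) * \<delta> ^ k * v ^ (d - k)))" by simp
  also have "(\<Sum>k = 2..d. of_nat (d choose k) * \<delta> ^ k * v ^ (d - k))
      = (\<Sum>k = 2..d. of_nat (d choose k) * \<delta> ^ (k - 1) * v ^ (d - k)) * \<delta>"
    unfolding sum_distrib_right
  proof (rule sum.cong)
    fix k assume "k \<in> {2..d}"
    then have "\<delta> ^ k = \<delta> ^ (k - 1) * \<delta>" by (cases k) auto
    then show "of_nat (d choose k) * \<delta> ^ k * v ^ (d - k)
        = of_nat (d choose k) * \<delta> ^ (k - 1) * v ^ (d - k) * \<delta>" by (simp only: algebra_simps)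
  qed simp
  finally show ?thesis by (simp add: algebra_simps)
qed

text \<open>At a = 0 the first coordinate vanishes and the second does not. This permits cancelling
  \<open>delta\<close> and adding degrees.\<close>

lemma delta_Suc_nonzero:
  assumes "d \<ge> 2"
  shows "delta d (Suc m) \<noteq> 0"
proof -
  have "poly (delta d (Suc m)) 0 = (int d - 1) * poly (orbit_q d (Suc m)) 0 ^ d"
    using assms unfolding delta_def poly_diff poly_mult poly_power poly_add poly_orbit_at_0(1)[OF assms]
    by (simp add: poly_of_nat_int power_0_left algebra_simps del: orbit_q.simps)
  also have "\<dots> \<noteq> 0" using poly_orbit_at_0(2)[OF assms] assms by (simp del: orbit_q.simps)
  finally show ?thesis by auto
qed

lemma misiurewicz_Suc:
  assumes "d \<ge> 2" "m \<ge> 1"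
  shows "(indet - of_nat d) * misiurewicz d (Suc m)
    = next_factor d (indet - of_nat d) indet (orbit_q d m) (delta d m)"
proof -
  define t q \<delta> v where "t = indet - of_nat d" "q = orbit_q d m" "\<delta> = delta d m" "v = indet * q ^ d"
  note defs = this
  define R where "R = (\<Sum>k = 2..d. of_nat (d choose k) * \<delta> ^ (k - 1) * v ^ (d - k))"
  have "\<delta> \<noteq> 0" unfolding defs using delta_Suc_nonzero[OF assms(1), of "m - 1"] assms(2) by simp
  have "(orbit_q d (Suc m) - indet * orbit_q d m ^ d) * inner_quotient d (Suc m)
           = orbit_q d (Suc m) ^ d - (indet * orbit_q d m ^ d) ^ d"
    using inner_quotient_mult[of d "Suc m"] assms by (simp only: diff_Suc_1)
  then have "inner_quotient d (Suc m) * \<delta> = (v + \<delta>) ^ d - v ^ d"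
    unfolding orbit_q_Suc_delta defs by (simp add: mult.commute)
  also have "\<dots> = (of_nat d * v ^ (d - 1) + R) * \<delta>"
    unfolding R_def using assms by (intro power_add_diff_eq) simp
  finally have inner: "inner_quotient d (Suc m) = of_nat d * v ^ (d - 1) + R"
    using \<open>\<delta> \<noteq> 0\<close> by simp
  have a: "indet = t + of_nat d" by (simp add: defs)
  \<comment> \<open>Only one factor of \<open>indet ^ d\<close> is expanded:
    \<open>t + d - (1 + t) * d = - (d - 1) * t\<close> then gives the \<delta>-free term of
    \<open>next_factor\<close>.\<close>
  have A: "indet ^ d = indet ^ (d - 1) * (t + of_nat d)"
    unfolding a[symmetric] using assms by (metis power_minus_mult zero_less_numeral less_le_trans)
  have B: "v ^ (d - 1) = indet ^ (d - 1) * q ^ (d * (d - 1))"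
    unfolding defs(4) by (simp only: power_mult_distrib power_mult[symmetric])
  have C: "of_nat (d - 1) = (of_nat d - 1 :: int poly)"
    using assms by (simp add: of_nat_diff)
  have "misiurewicz_numerator d (Suc m) = next_factor d t indet q \<delta>"
    unfolding misiurewicz_numerator_def inner next_factor_def diff_Suc_1 defs(1,2)[symmetric] R_def[symmetric]
      defs(4)[symmetric] A B C by (simp only: algebra_simps mult_1_left mult_1_right)
  then show ?thesis using misiurewicz_mult[of d "Suc m"] assms by (simp add: defs)
qed

text \<open>
  After the substitution \<open>a = d (1 + c)\<close>, \<open>orbit_q d (i + 1)\<close> and \<open>delta d (i + 1)\<close> are divisible by the
  powers of \<open>d\<close> with exponents \<open>d ^ i\<close> and \<open>d ^ (i + 1)\<close>; these are the quotients, as polynomials in \<open>c\<close>.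
  Note the index shift by one.
\<close>

fun scaled_q :: "nat \<Rightarrow> nat \<Rightarrow> int poly"
and scaled_delta :: "nat \<Rightarrow> nat \<Rightarrow> int poly" where
  "scaled_q d 0 = 1"
| "scaled_delta d 0 = [:1, 1:] ^ d - 1 - [:0, int d:]"
| "scaled_q d (Suc i) = [:int d, int d:] * scaled_q d i ^ d + scaled_delta d i"
| "scaled_delta d (Suc i) = scaled_delta d i *
     next_factor d [:0, int d:] [:int d, int d:] (scaled_q d i) (scaled_delta d i)"

abbreviation scaled_factor :: "nat \<Rightarrow> nat \<Rightarrow> int poly" where
  "scaled_factor d i \<equiv>
     next_factor d [:0, int d:] [:int d, int d:] (scaled_q d i) (scaled_delta d i)"

section \<open>The substitution a = d (1 + c)\<close>

lemma pcompose_of_nat: "pcompose (of_nat n) r = of_nat n"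
  by (induction n) (simp_all add: pcompose_add pcompose_1)

lemma pcompose_next_factor:
  "pcompose (next_factor d t a q \<delta>) r
     = next_factor d (pcompose t r) (pcompose a r) (pcompose q r) (pcompose \<delta> r)"
  unfolding next_factor_def
  by (simp only: pcompose_diff pcompose_uminus pcompose_mult pcompose_add pcompose_power
      pcompose_sum pcompose_of_nat pcompose_1)

text \<open>With \<open>q\<close> in degree 1 and \<delta> in degree \<open>d\<close>, every term is
  homogeneous of degree \<open>d * (d - 1)\<close>. This is why powers of d can be removed
  throughout the recursion.\<close>

lemma next_factor_homogeneous:
  "next_factor d t a (c * q) (c ^ d * \<delta>) = c ^ (d * (d - 1)) * next_factor d t a q \<delta>"
proof -
  have "of_nat (d choose k) * (c ^ d * \<delta>) ^ (k - 1) * (a * (c * q) ^ d) ^ (d - k)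
      = c ^ (d * (d - 1)) * (of_nat (d choose k) * \<delta> ^ (k - 1) * (a * q ^ d) ^ (d - k))"
    if "k \<in> {2..d}" for k
  proof -
    have "d * (d - 1) = d * (k - 1) + d * (d - k)"
      using that by (simp flip: distrib_left)
    then have "c ^ (d * (d - 1)) = (c ^ d) ^ (k - 1) * (c ^ d) ^ (d - k)"
      by (simp only: power_add power_mult)
    then show ?thesis by (simp only: power_mult_distrib mult.commute mult.left_commute mult.assoc)
  qed
  moreover define S where "S = (\<Sum>k = 2..d. of_nat (d choose k) * \<delta> ^ (k - 1) * (a * q ^ d) ^ (d - k))"
  ultimately have "(\<Sum>k = 2..d. of_nat (d choose k) * (c ^ d * \<delta>) ^ (k - 1) * (a * (c * q) ^ d) ^ (d - k))
    = c ^ (d * (d - 1)) * S"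
    by (simp add: sum_distrib_left)
  then show ?thesis
    unfolding next_factor_def S_def[symmetric]
    by (simp only: power_mult_distrib algebra_simps mult_minus_right)
qed

lemma pcompose_indet: "pcompose indet r = r"
  by (simp add: pcompose_pCons)

lemma pcompose_indet_diff: "pcompose (indet - of_nat d) [:int d, int d:] = [:0, int d:]"
  by (simp add: pcompose_pCons of_nat_poly)

lemma pcompose_orbit_delta:
  assumes "d \<ge> 2"
  shows "pcompose (orbit_q d (Suc i)) [:int d, int d:] = of_nat d ^ (d ^ i) * scaled_q d i \<and>
    pcompose (delta d (Suc i)) [:int d, int d:] = of_nat d ^ (d ^ Suc i) * scaled_delta d i"
proof (induction i)
  case 0
  have "[:int d, int d:] = of_nat d * [:1, 1:]" by (simp add: of_nat_poly)
  then have A: "[:int d, int d:] ^ d = of_nat d ^ d * [:1, 1:] ^ d" by (simp only: power_mult_distrib)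
  have p1: "orbit_p d (Suc 0) = indet" and q1: "orbit_q d (Suc 0) = of_nat d" by simp_all
  have "pcompose (delta d (Suc 0)) [:int d, int d:] = of_nat d ^ d * scaled_delta d 0"
    unfolding delta_def p1 q1 pcompose_diff[of "_ ^ d"] pcompose_mult pcompose_power pcompose_add
      pcompose_indet_diff pcompose_indet pcompose_of_nat pcompose_1 A scaled_delta.simps
    by (simp only: algebra_simps mult_1_left mult_1_right)
  then show ?case unfolding q1 by (simp add: pcompose_of_nat)
next
  case (Suc i)
  let ?r = "[:int d, int d:]"
  let ?c = "of_nat d ^ (d ^ i) :: int poly"
  let ?c' = "of_nat d ^ (d ^ Suc i) :: int poly"
  \<comment> \<open>\<open>?c\<close> scales q and its \<open>d\<close>-th power scales \<delta>,
    matching the homogeneity of \<open>next_factor\<close>.\<close>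
  have c: "?c ^ d = ?c'" by (simp add: mult.commute flip: power_mult)
  have c': "?c' ^ d = of_nat d ^ (d ^ Suc (Suc i))" by (simp add: mult.commute flip: power_mult)
  have IH: "pcompose (orbit_q d (Suc i)) ?r = ?c * scaled_q d i"
    "pcompose (delta d (Suc i)) ?r = ?c ^ d * scaled_delta d i"
    using Suc c by auto
  have "pcompose (orbit_q d (Suc (Suc i))) ?r = ?c' * scaled_q d (Suc i)"
    unfolding orbit_q_Suc_delta[of d "Suc i"] pcompose_add pcompose_mult pcompose_power IH pcompose_indet
      c[symmetric] scaled_q.simps(2)
    by (simp only: power_mult_distrib algebra_simps)
  moreover have "pcompose ((indet - of_nat d) * misiurewicz d (Suc (Suc i))) ?r
      = ?c ^ (d * (d - 1)) * scaled_factor d i"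
    unfolding misiurewicz_Suc[OF assms le_add1, of i, unfolded plus_1_eq_Suc] pcompose_next_factor
      pcompose_indet_diff IH pcompose_indet next_factor_homogeneous ..
  then have "pcompose (delta d (Suc (Suc i))) ?r
      = ?c ^ (d * (d - 1)) * scaled_factor d i * (?c ^ d * scaled_delta d i)"
    using delta_Suc[of d "Suc i"] assms IH(2) by (simp add: pcompose_mult)
  then have "pcompose (delta d (Suc (Suc i))) ?r
      = ?c ^ (d * (d - 1) + d) * scaled_delta d (Suc i)"
    by (simp only: power_add scaled_delta.simps ac_simps)
  moreover have "d * (d - 1) + d = d * d" using assms by (cases d) auto
  ultimately show ?case by (simp only: power_mult c c')
qed

lemma pcompose_misiurewicz:
  assumes "d \<ge> 2"
  shows "[:0, int d:] * pcompose (misiurewicz d (Suc (Suc i))) [:int d, int d:]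
    = of_nat d ^ (d ^ Suc i * (d - 1)) * scaled_factor d i"
proof -
  have "d ^ i * (d * (d - 1)) = d ^ Suc i * (d - 1)" by simp
  then have c: "(of_nat d ^ d ^ i) ^ (d * (d - 1)) = (of_nat d :: int poly) ^ (d ^ Suc i * (d - 1))"
    by (metis power_mult)
  have c': "of_nat d ^ d ^ Suc i = ((of_nat d :: int poly) ^ d ^ i) ^ d"
    by (simp add: mult.commute flip: power_mult)
  show ?thesis
    using arg_cong[OF misiurewicz_Suc[of d "Suc i"], of "\<lambda>f. pcompose f [:int d, int d:]"]
      pcompose_orbit_delta[OF assms, of i] assms
    unfolding pcompose_mult pcompose_next_factor pcompose_indet_diff pcompose_indet c'
    by (simp only: next_factor_homogeneous c)
qed

text \<open>The scaled recursion starts at index 1, so m = 1 is treated apart. The square arises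
  because \<open>delta d 0\<close> is itself d - a.\<close>

lemma pcompose_misiurewicz_1:
  assumes "d \<ge> 2"
  shows "[:0, int d:] ^ 2 * pcompose (misiurewicz d 1) [:int d, int d:] = - (of_nat d ^ d * scaled_delta d 0)"
proof -
  have "delta d 0 = - (indet - of_nat d)" by (simp add: delta_def)
  then have "delta d 1 = - ((indet - of_nat d) ^ 2 * misiurewicz d 1)"
    using delta_Suc[of d 0] assms by (simp only: One_nat_def power2_eq_square mult_minus_right ac_simps)
  from arg_cong[OF this, of "\<lambda>f. pcompose f [:int d, int d:]"] show ?thesis
    using pcompose_orbit_delta[OF assms, of 0]
    by (simp add: pcompose_uminus pcompose_mult pcompose_power pcompose_indet_diff)
qed

subsection \<open>The Newton polygon of a Misiurewicz polynomial\<close>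

text \<open>Here and in the next two lemmas k = d - 1, E = \<open>d ^ i\<close>, and
  \<open>Q = (E - 1) / (d - 1)\<close> is the exponent of d in the constant term of
  \<open>scaled_q\<close>. The left side is the weight of \<open>\<delta> ^ (d - 1)\<close>, the
  right side that of the term of \<open>next_factor\<close> outside the sum.\<close>

lemma weight_first_term:
  fixes n e k E :: nat
  assumes "n + 1 = e * k" and "k * Q + 1 = E" and "Suc k * E \<le> e"
  shows "k * (Suc k * E * e) \<le> n + e + k * n + Suc k * k * (n * Q)"
proof -
  have "k * (Suc k * E * e) = Suc k * E * (n + 1)" unfolding assms(1) by (simp only: ac_simps)
  also have "\<dots> \<le> Suc k * E * n + e" using assms(3) by simp
  also have "\<dots> = n + e + k * n + Suc k * k * (n * Q)" by (simp add: algebra_simps flip: assms(2))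
  finally show ?thesis .
qed

text \<open>Trading a factor \<delta> for \<open>a * q ^ d\<close> costs weight
  \<open>(n + D) / k\<close>, where \<open>D = d * E\<close>. The prime in the binomial coefficient
  pays \<open>n\<close>, enough for \<open>l < k\<close> trades because
  \<open>D * k \<le> n + 1\<close>.\<close>

lemma weight_middle_terms:
  fixes n e k E Q l :: nat
  assumes "n + 1 = e * k" and "k * Q + 1 = E" and "Suc k * E \<le> e" and "1 \<le> l" "l < k"
  shows "k * (Suc k * E * e) \<le> n + (k - l) * (Suc k * E * e) + l * (n + Suc k * (n * Q))"
proof -
  define D where "D = Suc k * E"
  have D: "k * (1 + Suc k * Q) + 1 = D" unfolding D_def assms(2)[symmetric] by (simp add: algebra_simps)
  have "l * D * (n + 1) \<le> k * n + l * n * (D - 1)"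
  proof -
    obtain r where r: "k = l + Suc r" using assms(5) less_imp_Suc_add by auto
    have "D * k \<le> n + 1" unfolding assms(1) using assms(3) by (simp add: D_def)
    moreover have "D \<ge> 1" using D by simp
    ultimately have "l * D \<le> n" unfolding r by (simp add: algebra_simps)
    also have "n \<le> Suc r * n" by simp
    finally have "l * D + l * n \<le> k * n" unfolding r by (simp add: algebra_simps)
    moreover have "l * D * (n + 1) = l * D + l * n + l * n * (D - 1)"
      using \<open>D \<ge> 1\<close> by (cases D) (simp_all add: algebra_simps)
    ultimately show ?thesis by linarith
  qed
  also have "l * D * (n + 1) = k * (l * D * e)" unfolding assms(1) by (simp only: ac_simps)
  also have "k * n + l * n * (D - 1) = k * (n + l * (n + Suc k * (n * Q)))"
    unfolding D[symmetric] by (simp add: algebra_simps)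
  finally have "l * D * e \<le> n + l * (n + Suc k * (n * Q))" using assms(4,5) by simp
  moreover have "k * (D * e) = (k - l) * (D * e) + l * (D * e)"
    using assms(5) by (simp flip: distrib_right)
  ultimately show ?thesis unfolding D_def by (simp only: mult.assoc)
qed

text \<open>The bound for \<delta> is at least that for \<open>a * q ^ d\<close>, so their sum, the
  next q, keeps the latter, with \<open>1 + d * Q\<close> in place of \<open>Q\<close>.\<close>

lemma weight_q:
  fixes n e k E Q :: nat
  assumes "n + 1 = e * k" and "k * Q + 1 = E" and "k \<ge> 1"
  shows "n * (1 + Suc k * Q) \<le> Suc k * E * e"
proof -
  have "k * (1 + Suc k * Q) \<le> Suc k * E" unfolding assms(2)[symmetric] by (simp add: algebra_simps)
  then have "k * (1 + Suc k * Q) * (n + 1) \<le> Suc k * E * (n + 1)" by (rule mult_le_mono1)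
  also have "\<dots> = k * (Suc k * E * e)" unfolding assms(1) by (simp only: ac_simps)
  finally have "k * ((1 + Suc k * Q) * (n + 1)) \<le> k * (Suc k * E * e)" by (simp only: mult.assoc)
  then have "(1 + Suc k * Q) * (n + 1) \<le> Suc k * E * e"
    by (rule mult_left_le_imp_le) (use assms(3) in simp)
  then show ?thesis by (simp add: algebra_simps)
qed

section \<open>Weight bounds along the scaled recursion\<close>

lemma newton_ge_const_mult:
  assumes "n > 0" "newton_ge p n e s f"
  shows "newton_ge p n e s (g * f)"
  using newton_ge_mult[OF assms(1) newton_ge_0 assms(2)] by simp

lemma newton_ge_of_nat:
  assumes "d dvd c"
  shows "newton_ge (int d) n e n (of_nat c)"
  using newton_ge_dvd_const[of "int d" "int c"] assms by (simp add: of_nat_poly)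

lemma newton_ge_linear:
  assumes "n > 0"
  shows "newton_ge (int d) n e n [:int d, int d:]"
proof -
  have "[:int d, int d:] = [:1, 1:] * of_nat d" by (simp add: of_nat_poly)
  then show ?thesis using newton_ge_const_mult[OF assms newton_ge_of_nat[of d d], of e "[:1, 1:]"] by simp
qed

lemma newton_ge_monomial:
  assumes "n > 0"
  shows "newton_ge (int d) n e (n + e) [:0, int d:]"
  using newton_ge_mult[OF assms newton_ge_of_nat[of d d] newton_ge_X[OF assms]]
  by (simp add: of_nat_poly)

text \<open>
  The bound comes from the last term \<open>\<delta> ^ (d - 1)\<close> of the sum; the terms \<open>2 \<le> k < d\<close> gain a factor \<open>d\<close> from the
  binomial coefficient. The term outside the sum ties with it when \<open>d * E = e\<close>, whence the two ends of the edge.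
\<close>

lemma newton_ge_next_factor:
  assumes d: "prime d" and n: "n + 1 = e * (d - 1)" "n > 0"
    and E: "(d - 1) * Q + 1 = E" "d * E \<le> e"
    and q: "newton_ge (int d) n e (n * Q) q"
    and \<delta>: "newton_ge (int d) n e (d * E * e) \<delta>"
  shows "newton_ge (int d) n e ((d - 1) * (d * E * e)) (next_factor d [:0, int d:] [:int d, int d:] q \<delta>)"
proof -
  obtain k where k: "d = Suc k" "k \<ge> 1" using d prime_ge_2_nat[of d] by (cases d) auto
  let ?A = "[:int d, int d:]" and ?T = "[:0, int d:]"
  have pow: "newton_ge (int d) n e (j * s) (f ^ j)" if "newton_ge (int d) n e s f" for j s f
    using newton_ge_power[OF n(2) that] .
  have mul: "newton_ge (int d) n e (s + t) (f * g)"
    if "newton_ge (int d) n e s f" "newton_ge (int d) n e t g" for s t f g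
    using newton_ge_mult[OF n(2) that] .
  have "newton_ge (int d) n e (n + e + (d - 1) * n + d * (d - 1) * (n * Q))
      (?T * ?A ^ (d - 1) * q ^ (d * (d - 1)))"
    by (intro mul pow newton_ge_linear newton_ge_monomial n q)
  moreover have "(d - 1) * (d * E * e) \<le> n + e + (d - 1) * n + d * (d - 1) * (n * Q)"
    using weight_first_term[of n e k Q E] n E unfolding k diff_Suc_1 by blast
  ultimately have "newton_ge (int d) n e ((d - 1) * (d * E * e)) (?T * ?A ^ (d - 1) * q ^ (d * (d - 1)))"
    by (rule newton_ge_mono)
  then have first: "newton_ge (int d) n e ((d - 1) * (d * E * e))
      (of_nat (d - 1) * ?T * ?A ^ (d - 1) * q ^ (d * (d - 1)))"
    using newton_ge_const_mult[OF n(2)] by (simp only: mult.assoc)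
  have "newton_ge (int d) n e ((d - 1) * (d * E * e))
      (of_nat (d choose j) * \<delta> ^ (j - 1) * (?A * q ^ d) ^ (d - j))" if j: "j \<in> {2..d}" for j
  proof (cases "j = d")
    case True
    then show ?thesis using pow[OF \<delta>, of "d - 1"] by simp
  next
    case False
    have "newton_ge (int d) n e n (of_nat (d choose j))"
      using False j d by (intro newton_ge_of_nat dvd_choose_prime) auto
    then have "newton_ge (int d) n e (n + (j - 1) * (d * E * e) + (d - j) * (n + d * (n * Q)))
      (of_nat (d choose j) * \<delta> ^ (j - 1) * (?A * q ^ d) ^ (d - j))"
      by (intro mul pow newton_ge_linear n q \<delta>)
    moreover have "(d - 1) * (d * E * e) \<le> n + (j - 1) * (d * E * e) + (d - j) * (n + d * (n * Q))"
    proof -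
      have "n + 1 = e * k" "k * Q + 1 = E" "Suc k * E \<le> e" "1 \<le> d - j" "d - j < k" "k - (d - j) = j - 1"
        using n E k j False by auto
      then show ?thesis using weight_middle_terms[of n e k Q E "d - j"] by (simp only: k diff_Suc_1)
    qed
    ultimately show ?thesis by (rule newton_ge_mono)
  qed
  then have "newton_ge (int d) n e ((d - 1) * (d * E * e))
    ((1 + ?T) * (\<Sum>k = 2..d. of_nat (d choose k) * \<delta> ^ (k - 1) * (?A * q ^ d) ^ (d - k)))"
    by (rule newton_ge_const_mult[OF n(2) newton_ge_sum[OF n(2)]])
  with first show ?thesis unfolding next_factor_def by (intro newton_ge_diff newton_ge_uminus)
qed

lemma scaled_delta_0:
  assumes "d \<ge> 2"
  shows "scaled_delta d 0 = (\<Sum>k = 2..d. of_nat (d choose k) * [:0, 1:] ^ k)"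
proof -
  have "[:1, 1:] ^ d = ([:0, 1:] + 1 :: int poly) ^ d" by (simp add: one_pCons)
  also have "\<dots> = (\<Sum>k\<le>d. of_nat (d choose k) * [:0, 1:] ^ k)" by (simp add: binomial_ring)
  also have "{..d} = insert 0 (insert 1 {2..d})" using assms by auto
  also have "(\<Sum>k\<in>\<dots>. of_nat (d choose k) * [:0, 1:] ^ k)
      = 1 + ([:0, int d:] + (\<Sum>k = 2..d. of_nat (d choose k) * [:0, 1:] ^ k))"
    by (simp add: of_nat_poly)
  finally show ?thesis by simp
qed

text \<open>All levels are measured against the slope of the one edge sought, whence
  \<open>d ^ i \<le> e\<close>. Divisibility by the square of c keeps \<delta> out of the
  coefficients read off at the left end, which are then exact powers of d up to a unit
  factor.\<close>

lemma newton_ge_scaled: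
  assumes d: "prime d" and n: "n + 1 = e * (d - 1)" "n > 0" and "d ^ i \<le> e"
  shows "newton_ge (int d) n e (d ^ Suc i * e) (scaled_delta d i) \<and>
    (\<exists>Q. (d - 1) * Q + 1 = d ^ i \<and> newton_ge (int d) n e (n * Q) (scaled_q d i) \<and>
      coeff (scaled_q d i) 0 = int d ^ Q) \<and> [:0, 1:] ^ 2 dvd scaled_delta d i"
  using assms(4)
proof (induction i)
  case 0
  obtain k where k: "d = Suc k" "k \<ge> 1" using d prime_ge_2_nat[of d] by (cases d) auto
  have X: "newton_ge (int d) n e (j * e) ([:0, 1:] ^ j)" for j
    by (intro newton_ge_power newton_ge_X n)
  have "newton_ge (int d) n e (d * e) (of_nat (d choose j) * [:0, 1:] ^ j)" if j: "j \<in> {2..d}" for j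
  proof (cases "j = d")
    case True
    then show ?thesis using X[of d] by simp
  next
    case False
    then have "newton_ge (int d) n e (n + j * e) (of_nat (d choose j) * [:0, 1:] ^ j)"
      using d j by (intro newton_ge_mult n newton_ge_of_nat dvd_choose_prime X) auto
    moreover have "d * e \<le> n + j * e"
    proof -
      have "e \<ge> 1" using n by (cases e) auto
      have "d * e = n + 1 + e" using n k by simp
      also have "\<dots> \<le> n + 2 * e" using \<open>e \<ge> 1\<close> by simp
      also have "\<dots> \<le> n + j * e" using j by simp
      finally show ?thesis .
    qed
    ultimately show ?thesis by (rule newton_ge_mono)
  qed
  then have "newton_ge (int d) n e (d * e) (scaled_delta d 0)"
    unfolding scaled_delta_0[OF prime_ge_2_nat[OF d]] by (intro newton_ge_sum n)
  moreover have "[:0, 1:] ^ 2 dvd scaled_delta d 0"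
    unfolding scaled_delta_0[OF prime_ge_2_nat[OF d]]
    by (intro dvd_sum dvd_mult le_imp_power_dvd) auto
  ultimately show ?case by (auto simp: newton_ge_0)
next
  case (Suc i)
  have "d ^ i \<le> d ^ Suc i" using prime_gt_0_nat[OF d] by simp
  with Suc obtain Q where IH: "newton_ge (int d) n e (d * d ^ i * e) (scaled_delta d i)"
    "(d - 1) * Q + 1 = d ^ i" "newton_ge (int d) n e (n * Q) (scaled_q d i)"
    "coeff (scaled_q d i) 0 = int d ^ Q" "[:0, 1:] ^ 2 dvd scaled_delta d i"
    by auto
  obtain k where k: "d = Suc k" "k \<ge> 1" using d prime_ge_2_nat[of d] by (cases d) auto
  have "newton_ge (int d) n e (d * d ^ i * e + (d - 1) * (d * d ^ i * e)) (scaled_delta d (Suc i))"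
    unfolding scaled_delta.simps
    using Suc.prems IH by (intro newton_ge_mult newton_ge_next_factor n d) auto
  also have "d * d ^ i * e + (d - 1) * (d * d ^ i * e) = d ^ Suc (Suc i) * e"
    using k by (simp add: algebra_simps)
  finally have "newton_ge (int d) n e (d ^ Suc (Suc i) * e) (scaled_delta d (Suc i))" .
  moreover have "newton_ge (int d) n e (n * (1 + d * Q)) (scaled_q d (Suc i))"
  proof -
    have "newton_ge (int d) n e (n + d * (n * Q)) ([:int d, int d:] * scaled_q d i ^ d)"
      by (intro newton_ge_mult newton_ge_power newton_ge_linear n IH)
    moreover have "n * (1 + d * Q) \<le> d * d ^ i * e"
      using weight_q[of n e k Q "d ^ i"] n IH(2) k by simp
    moreover have "n + d * (n * Q) = n * (1 + d * Q)" by (simp add: algebra_simps)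
    ultimately show ?thesis
      unfolding scaled_q.simps by (intro newton_ge_add newton_ge_mono[OF IH(1)]) simp_all
  qed
  moreover have "(d - 1) * (1 + d * Q) + 1 = d ^ Suc i"
    unfolding power_Suc IH(2)[symmetric] using k by (simp add: algebra_simps)
  moreover have "coeff (scaled_q d (Suc i)) 0 = int d ^ (1 + d * Q)"
  proof -
    have "coeff (scaled_delta d i) 0 = 0" using IH(5) by (auto simp: dvd_def power2_eq_square)
    then show ?thesis by (simp add: coeff_0_power IH(4) mult.commute flip: power_mult)
  qed
  moreover have "[:0, 1:] ^ 2 dvd scaled_delta d (Suc i)"
    unfolding scaled_delta.simps using IH(5) by (rule dvd_mult2)
  ultimately show ?case by (intro conjI exI[of _ "1 + d * Q"])
qed

text \<open>Every term of the sum in \<open>next_factor\<close> contains \<delta>, hence the square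
  of c, so only the term outside it reaches index 1. Its exponent of d is
  \<open>d + d * (d - 1) * Q = d ^ Suc i\<close>. This is the left end of the edge before c is
  divided out.\<close>

lemma coeff_1_scaled_factor:
  assumes "(d - 1) * Q + 1 = d ^ i" and "coeff (scaled_q d i) 0 = int d ^ Q"
    and "[:0, 1:] ^ 2 dvd scaled_delta d i" "d \<ge> 2"
  shows "coeff (scaled_factor d i) 0 = 0" "coeff (scaled_factor d i) 1 = - (int (d - 1) * int d ^ (d ^ Suc i))"
proof -
  let ?f = "of_nat (d - 1) * [:int d, int d:] ^ (d - 1) * scaled_q d i ^ (d * (d - 1))"
  let ?g = "(1 + [:0, int d:]) * (\<Sum>k = 2..d. of_nat (d choose k) * scaled_delta d i ^ (k - 1)
    * ([:int d, int d:] * scaled_q d i ^ d) ^ (d - k))"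
  have "[:0, 1:] ^ 2 dvd scaled_delta d i ^ (k - 1)" if "k \<in> {2..d}" for k
    using that by (intro dvd_trans[OF assms(3) dvd_power]) auto
  then have "[:0, 1:] ^ 2 dvd ?g"
    by (intro dvd_mult[of _ _ "1 + [:0, int d:]"] dvd_sum dvd_mult2[OF dvd_mult])
  then obtain r where r: "?g = [:0, 1:] ^ 2 * r" by blast
  have eq: "scaled_factor d i = pCons 0 (smult (- int d) ?f - pCons 0 r)"
    unfolding next_factor_def r by (simp add: power2_eq_square)
  show "coeff (scaled_factor d i) 0 = 0" unfolding eq by simp
  have "d + d * (d - 1) * Q = d * d ^ i" unfolding assms(1)[symmetric] by (simp add: algebra_simps)
  moreover have "int d * int d ^ (d - 1) * int d ^ (Q * (d * (d - 1))) = int d ^ (d + d * (d - 1) * Q)"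
    using assms(4) by (cases d) (auto simp: power_add mult.commute)
  ultimately show "coeff (scaled_factor d i) 1 = - (int (d - 1) * int d ^ (d ^ Suc i))"
    unfolding eq by (simp add: coeff_0_power coeff_mult_0 assms(2) of_nat_poly flip: power_mult)
qed

section \<open>Reduction modulo d\<close>

lemma dvd_diff_power:
  fixes x y c :: "'a :: comm_ring_1"
  assumes "c dvd x - y"
  shows "c dvd x ^ n - y ^ n"
  unfolding power_diff_sumr2 using assms by (rule dvd_mult2)

lemma of_nat_dvd:
  assumes "m dvd n"
  shows "(of_nat m :: 'a :: comm_semiring_1) dvd of_nat n"
  using assms by (auto elim!: dvdE)

lemma dvd_choose_sum:
  fixes f :: "nat \<Rightarrow> int poly"
  assumes "prime d"
  shows "of_nat d dvd (\<Sum>k = 2..d. of_nat (d choose k) * f k) - f d"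
proof -
  have "{2..d} = insert d {2..<d}" using prime_ge_2_nat[OF assms] by auto
  then have "(\<Sum>k = 2..d. of_nat (d choose k) * f k) = f d + (\<Sum>k = 2..<d. of_nat (d choose k) * f k)"
    by simp
  moreover have "of_nat d dvd (\<Sum>k = 2..<d. of_nat (d choose k) * f k)"
    using assms by (intro dvd_sum dvd_mult2 of_nat_dvd dvd_choose_prime) auto
  ultimately show ?thesis by simp
qed

text \<open>The term outside the sum and \<open>t\<close> both carry a factor d, and modulo d the
  binomial coefficients leave only k = d.\<close>

lemma next_factor_mod:
  assumes "prime d"
  shows "of_nat d dvd next_factor d [:0, int d:] [:int d, int d:] q \<delta> + \<delta> ^ (d - 1)"
proof -
  define S where "S = (\<Sum>k = 2..d. of_nat (d choose k) * (\<delta> ^ (k - 1) * ([:int d, int d:] * q ^ d) ^ (d - k)))"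
  have S: "of_nat d dvd S - \<delta> ^ (d - 1)"
    using dvd_choose_sum[OF assms, of "\<lambda>k. \<delta> ^ (k - 1) * ([:int d, int d:] * q ^ d) ^ (d - k)"]
    by (simp add: S_def)
  have "[:0, int d:] = of_nat d * [:0, 1:]" by (simp add: of_nat_poly)
  then have "of_nat d dvd [:0, int d:]" by (metis dvd_triv_left)
  then have "of_nat d dvd of_nat (d - 1) * [:0, int d:] * [:int d, int d:] ^ (d - 1) * q ^ (d * (d - 1)) + [:0, int d:] * S"
    by (intro dvd_add dvd_mult2 dvd_mult) auto
  then have "of_nat d dvd - (of_nat (d - 1) * [:0, int d:] * [:int d, int d:] ^ (d - 1) * q ^ (d * (d - 1)) + [:0, int d:] * S)
    - (S - \<delta> ^ (d - 1))"
    using S by (intro dvd_diff[OF _ S]) (simp only: dvd_minus_iff)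
  also have "\<dots> = next_factor d [:0, int d:] [:int d, int d:] q \<delta> + \<delta> ^ (d - 1)"
    unfolding next_factor_def S_def[unfolded mult.assoc[symmetric], symmetric] by (simp only: algebra_simps mult_1_left)
  finally show ?thesis .
qed

text \<open>Modulo d the recursion reads \<open>\<delta> \<mapsto> - (\<delta> ^ d)\<close>, so only
  a signed monomial remains. The sign stays open because only an even power is used later.\<close>

lemma scaled_delta_mod:
  assumes "prime d"
  shows "\<exists>\<epsilon> \<in> {1, -1}. of_nat d dvd scaled_delta d i - \<epsilon> * [:0, 1:] ^ (d ^ Suc i)"
proof (induction i)
  case 0
  have "of_nat d dvd scaled_delta d 0 - [:0, 1:] ^ d"
    unfolding scaled_delta_0[OF prime_ge_2_nat[OF assms(1)]] by (rule dvd_choose_sum[OF assms(1)])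
  then show ?case by (intro bexI[of _ 1]) auto
next
  case (Suc i)
  then obtain \<epsilon> :: "int poly" where \<epsilon>: "\<epsilon> \<in> {1, -1}"
    "of_nat d dvd scaled_delta d i - \<epsilon> * [:0, 1:] ^ (d ^ Suc i)" by blast
  have "of_nat d dvd scaled_delta d i * (scaled_factor d i + scaled_delta d i ^ (d - 1))"
    by (intro dvd_mult next_factor_mod assms)
  also have "\<dots> = scaled_delta d (Suc i) + scaled_delta d i ^ d"
    using prime_gt_0_nat[OF assms] by (simp add: distrib_left power_eq_if)
  finally have "of_nat d dvd scaled_delta d (Suc i) + scaled_delta d i ^ d
    - (scaled_delta d i ^ d - (\<epsilon> * [:0, 1:] ^ (d ^ Suc i)) ^ d)"
    using dvd_diff_power[OF \<epsilon>(2), of d] by (rule dvd_diff)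
  also have "\<dots> = scaled_delta d (Suc i) - (- (\<epsilon> ^ d)) * [:0, 1:] ^ (d ^ Suc (Suc i))"
    by (simp add: power_mult_distrib mult.commute del: scaled_delta.simps flip: power_mult)
  finally show ?case
    using \<epsilon>(1) by (intro bexI[of _ "- (\<epsilon> ^ d)"]) (auto simp: minus_one_power_iff)
qed

text \<open>This gives the right end of the edge; for \<open>e = d ^ Suc i\<close> the exponent is
  \<open>n + 1\<close>.\<close>

lemma scaled_factor_mod:
  assumes "prime d" "odd d"
  shows "of_nat d dvd scaled_factor d i + [:0, 1:] ^ (d ^ Suc i * (d - 1))"
proof -
  obtain \<epsilon> :: "int poly" where \<epsilon>: "\<epsilon> \<in> {1, -1}"
    "of_nat d dvd scaled_delta d i - \<epsilon> * [:0, 1:] ^ (d ^ Suc i)"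
    using scaled_delta_mod[OF assms(1)] by blast
  have "\<epsilon> ^ (d - 1) = 1" using \<epsilon>(1) assms(2) by (auto simp: minus_one_power_iff)
  then have "of_nat d dvd scaled_delta d i ^ (d - 1) - [:0, 1:] ^ (d ^ Suc i * (d - 1))"
    using dvd_diff_power[OF \<epsilon>(2), of "d - 1"] by (simp only: power_mult_distrib power_mult mult_1_left)
  with next_factor_mod[OF assms(1)]
  have "of_nat d dvd scaled_factor d i + scaled_delta d i ^ (d - 1)
    - (scaled_delta d i ^ (d - 1) - [:0, 1:] ^ (d ^ Suc i * (d - 1)))" by (rule dvd_diff)
  then show ?thesis by (simp only: diff_diff_eq2 add_diff_cancel_left' algebra_simps)
qed

lemma of_nat_dvd_poly_iff: "(of_nat d :: int poly) dvd f \<longleftrightarrow> (\<forall>j. int d dvd coeff f j)"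
  by (simp add: of_nat_poly const_poly_dvd_iff)

lemma of_nat_power_mult_poly: "of_nat d ^ j * f = smult (int d ^ j) f"
  by (induction j) (simp_all add: of_nat_poly mult.assoc)

lemma not_dvd_coeff:
  assumes "d \<ge> 2" "of_nat d dvd f + [:0, 1:] ^ n"
  shows "\<not> int d dvd coeff f n"
proof
  assume "int d dvd coeff f n"
  moreover have "int d dvd coeff (f + [:0, 1:] ^ n) n"
    using assms(2) unfolding of_nat_dvd_poly_iff by blast
  then have "int d dvd coeff f n + 1" by (simp add: coeff_monom flip: monom_altdef[of 1, unfolded smult_1_left])
  ultimately have "int d dvd 1" using dvd_add_right_iff by blast
  then show False using assms(1) by simp
qed

text \<open>\<open>F\<close> comes from \<open>scaled_delta d 0\<close> by removing the square of c
  when m = 1, and from \<open>scaled_factor d (m - 2)\<close> by removing one c otherwise. The full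
  congruence modulo d, not only the coefficient at \<open>n\<close>, is recorded for the exclusion
  of roots.\<close>

lemma newton_polygon_misiurewicz:
  assumes d: "prime d" "d \<ge> 3" and m: "m \<ge> 1"
    and e: "e = d ^ (m - 1)" and n: "n = d ^ m - d ^ (m - 1) - 1"
  obtains \<alpha> \<beta> :: int and F where "\<alpha> \<noteq> 0" "\<beta> \<noteq> 0"
    "smult \<alpha> (pcompose (misiurewicz d m) [:int d, int d:]) = smult \<beta> F"
    "newton_ge (int d) n e (n * e) F" "of_nat d dvd F + [:0, 1:] ^ n"
    "coeff F 0 \<noteq> 0" "multiplicity (int d) (coeff F 0) = e"
proof (cases "m = 1")
  case True
  then have e: "e = 1" and n: "n = d - 2" using e n by auto
  have "odd d" using d by (simp add: prime_odd_nat)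
  then obtain l where l: "d = 2 * l + 1" by (elim oddE)
  define R :: "int poly" where "R = (\<Sum>k = 2..d. of_nat (d choose k) * [:0, 1:] ^ (k - 2))"
  have R: "scaled_delta d 0 = [:0, 1:] ^ 2 * R"
  proof -
    have "[:0, 1:] ^ 2 * [:0, 1:] ^ (k - 2) = ([:0, 1:] ^ k :: int poly)" if "k \<in> {2..d}" for k
      using that power_add[of "[:0, 1:] :: int poly" 2 "k - 2"] by (simp only: atLeastAtMost_iff le_add_diff_inverse)
    then show ?thesis
      using d unfolding R_def sum_distrib_left by (subst scaled_delta_0) (auto intro!: sum.cong simp: mult.left_commute)
  qed
  have "[:0, 1:] ^ 2 * smult ((int d) ^ 2) (pcompose (misiurewicz d 1) [:int d, int d:]) = [:0, 1:] ^ 2 * smult (int d ^ d) (- R)"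
  proof -
    have "[:0, int d:] ^ 2 = smult (int d ^ 2) ([:0, 1:] ^ 2)" by (simp add: power2_eq_square)
    then show ?thesis
      using pcompose_misiurewicz_1[of d] d unfolding R of_nat_power_mult_poly by simp
  qed
  then have "smult ((int d) ^ 2) (pcompose (misiurewicz d 1) [:int d, int d:]) = smult (int d ^ d) (- R)"
    by (subst (asm) mult_cancel_left) simp
  moreover have "newton_ge (int d) n e (n * e) (- R)"
  proof -
    have "newton_ge (int d) n e (d ^ Suc 0 * e) (scaled_delta d 0)"
      using newton_ge_scaled[of d n e 0] d by (simp add: e n)
    moreover have "d ^ Suc 0 * e = n * e + e + e" using d by (simp add: e n)
    ultimately have "newton_ge (int d) n e (n * e + e + e) ([:0, 1:] * ([:0, 1:] * R))"
      unfolding R power2_eq_square mult.assoc by simp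
    then show ?thesis by (rule newton_ge_uminus[OF newton_ge_divide_X[OF newton_ge_divide_X]])
  qed
  moreover have "of_nat d dvd - R + [:0, 1:] ^ n"
  proof -
    have "of_nat d dvd R - [:0, 1:] ^ n"
      unfolding R_def n by (rule dvd_choose_sum[OF d(1), of "\<lambda>k. [:0, 1:] ^ (k - 2)"])
    then have "of_nat d dvd - (R - [:0, 1:] ^ n)" by (simp only: dvd_minus_iff)
    then show ?thesis by simp
  qed
  moreover have R0: "coeff R 0 = int (d choose 2)"
  proof -
    have "coeff R 0 = (\<Sum>k = 2..d. if k = 2 then int (d choose k) else 0)"
      unfolding R_def coeff_sum
      by (intro sum.cong) (auto simp: coeff_mult_0 coeff_0_power of_nat_poly power_0_left)
    then show ?thesis using d by simp
  qed
  moreover have "multiplicity (int d) (coeff (- R) 0) = e"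
  proof -
    \<comment> \<open>As d is odd, \<open>d choose 2\<close> is d times (d - 1) / 2, and the second
      factor is prime to d.\<close>
    have choose: "d choose 2 = d * l" by (simp add: choose_two l)
    have "\<not> d dvd l"
    proof
      assume "d dvd l"
      then have "d \<le> l" using l d by (intro dvd_imp_le) auto
      then show False using l by simp
    qed
    then show ?thesis unfolding e
      by (intro multiplicity_eqI) (use R0 d in \<open>auto simp: choose\<close>)
  qed
  ultimately show ?thesis
    using that[of "int d ^ 2" "int d ^ d" "- R"] d True by simp
next
  case False
  then obtain i where i: "m = Suc (Suc i)" using m by (metis One_nat_def Suc_le_D old.nat.exhaust)
  have e: "e = d ^ Suc i" unfolding e i by simp
  have "e \<ge> 1" unfolding e using d by simp
  have "n + 1 = e * (d - 1)"
  proof -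
    have "e * (d - 1) \<ge> 1" using \<open>e \<ge> 1\<close> d by simp
    moreover have "e * (d - 1) = d ^ m - d ^ (m - 1)" unfolding i e by (simp add: diff_mult_distrib2 ac_simps)
    ultimately show ?thesis unfolding n by linarith
  qed
  have "e * (d - 1) \<ge> 1 * 2" using \<open>e \<ge> 1\<close> d by (intro mult_le_mono) auto
  then have "n > 0" using \<open>n + 1 = e * (d - 1)\<close> by simp
  note n = \<open>n + 1 = e * (d - 1)\<close> \<open>n > 0\<close>
  have "d ^ i \<le> e" unfolding e using d by simp
  obtain Q where Q: "newton_ge (int d) n e (d ^ Suc i * e) (scaled_delta d i)"
    "(d - 1) * Q + 1 = d ^ i" "newton_ge (int d) n e (n * Q) (scaled_q d i)"
    "coeff (scaled_q d i) 0 = int d ^ Q" "[:0, 1:] ^ 2 dvd scaled_delta d i"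
    using newton_ge_scaled[OF d(1) n \<open>d ^ i \<le> e\<close>] by blast
  have "newton_ge (int d) n e ((d - 1) * (d * d ^ i * e)) (scaled_factor d i)"
    using Q by (intro newton_ge_next_factor d n) (auto simp: e)
  \<comment> \<open>Here \<open>d * d ^ i = e\<close>, the case of a tie; the surplus
    \<open>e\<close> is spent on dividing out c.\<close>
  also have "(d - 1) * (d * d ^ i * e) = (n + 1) * e" unfolding n e by simp
  finally have H: "newton_ge (int d) n e (n * e + e) (scaled_factor d i)" by (simp add: add.commute)
  have "coeff (scaled_factor d i) 0 = 0"
    and H1: "coeff (scaled_factor d i) 1 = - (int (d - 1) * int d ^ e)"
    using coeff_1_scaled_factor[OF Q(2,4,5)] d by (auto simp: e)
  then obtain F where F: "scaled_factor d i = [:0, 1:] * F"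
    by (cases "scaled_factor d i") auto
  have F0: "coeff F 0 = - (int (d - 1) * int d ^ e)" using H1 unfolding F by simp
  have "[:0, 1:] * smult (int d) (pcompose (misiurewicz d m) [:int d, int d:])
      = [:0, 1:] * smult (int d ^ (d ^ Suc i * (d - 1))) F"
  proof -
    have "[:0, int d:] * f = [:0, 1:] * smult (int d) f" for f by simp
    then show ?thesis
      using pcompose_misiurewicz[of d i] d unfolding F i of_nat_power_mult_poly by simp
  qed
  then have "smult (int d) (pcompose (misiurewicz d m) [:int d, int d:])
      = smult (int d ^ (d ^ Suc i * (d - 1))) F"
    by (subst (asm) mult_cancel_left) simp
  moreover have "newton_ge (int d) n e (n * e) F"
    using H unfolding F by (rule newton_ge_divide_X)
  moreover have "of_nat d dvd F + [:0, 1:] ^ n"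
  proof -
    have "of_nat d dvd scaled_factor d i + [:0, 1:] ^ (e * (d - 1))"
      unfolding e using d by (intro scaled_factor_mod) (auto simp: prime_odd_nat)
    also have "\<dots> = [:0, 1:] * (F + [:0, 1:] ^ n)"
      unfolding F n(1)[symmetric] by (simp add: distrib_left)
    finally have "int d dvd coeff ([:0, 1:] * (F + [:0, 1:] ^ n)) (Suc j)" for j
      unfolding of_nat_dvd_poly_iff by blast
    then show ?thesis unfolding of_nat_dvd_poly_iff by simp
  qed
  moreover have "multiplicity (int d) (coeff F 0) = e"
  proof (rule multiplicity_eqI)
    show "int d ^ e dvd coeff F 0" unfolding F0 by simp
    show "\<not> int d ^ Suc e dvd coeff F 0"
    proof
      assume "int d ^ Suc e dvd coeff F 0"
      then have "int d dvd int (d - 1)" using d unfolding F0 by simp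
      then show False using d zdvd_imp_le[of "int d" "int (d - 1)"] by simp
    qed
  qed
  ultimately show ?thesis using that[of "int d" "int d ^ (d ^ Suc i * (d - 1))" F] d F0 by simp
qed

lemma degree_factor_misiurewicz:
  fixes g h :: "rat poly"
  assumes d: "prime d" "d \<ge> 3" and m: "m \<ge> 1"
    and gh: "map_poly of_int (misiurewicz d m) = g * h"
  shows "d ^ m - d ^ (m - 1) - 1 \<le> degree g \<or> d ^ m - d ^ (m - 1) - 1 \<le> degree h"
proof (cases "d ^ m - d ^ (m - 1) - 1 = 0")
  case False
  define e n where "e = d ^ (m - 1)" and "n = d ^ m - d ^ (m - 1) - 1"
  obtain \<alpha> \<beta> F where F: "\<alpha> \<noteq> 0" "\<beta> \<noteq> 0"
    "smult \<alpha> (pcompose (misiurewicz d m) [:int d, int d:]) = smult \<beta> F"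
    "newton_ge (int d) n e (n * e) F" "of_nat d dvd F + [:0, 1:] ^ n"
    "coeff F 0 \<noteq> 0" "multiplicity (int d) (coeff F 0) = e"
    using newton_polygon_misiurewicz[OF d m e_def n_def] by blast
  \<comment> \<open>Coprimality holds because \<open>n + 1\<close> is a multiple of
    \<open>e\<close>.\<close>
  have "coprime e n"
  proof (rule coprimeI)
    fix c assume "c dvd e" "c dvd n"
    have "d ^ m = d * e" using m by (simp add: e_def flip: power_Suc)
    then have "n + 1 = d * e - e" using False by (simp add: n_def e_def)
    then have "n + 1 = e * (d - 1)" by (simp add: diff_mult_distrib2 mult.commute)
    then have "c dvd n + 1" using \<open>c dvd e\<close> by simp
    then show "is_unit c" using \<open>c dvd n\<close> by (simp only: dvd_add_right_iff)
  qed
  then show ?thesis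
    using degree_factor_ge[OF _ _ _ F(1,2) _ F(3,4) _ F(6,7) gh] not_dvd_coeff[OF _ F(5)] d False
    by (simp add: n_def)
qed simp

text \<open>The congruence forces d to divide a root c. As \<open>e < n\<close>, all nonconstant
  terms are then divisible by \<open>d ^ Suc e\<close>, while the constant term is not.\<close>

lemma no_integer_root:
  assumes d: "prime d" and ge: "newton_ge (int d) n e (n * e) F" and "e < n"
    and dvd: "of_nat d dvd F + [:0, 1:] ^ n"
    and F0: "coeff F 0 \<noteq> 0" "multiplicity (int d) (coeff F 0) = e"
  shows "poly F c \<noteq> 0"
proof
  assume root: "poly F c = 0"
  obtain r where "F + [:0, 1:] ^ n = of_nat d * r" using dvd by (elim dvdE)
  from arg_cong[OF this, of "\<lambda>f. poly f c"] have "c ^ n = int d * poly r c"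
    by (simp add: root of_nat_poly)
  then have "int d dvd c ^ n" by simp
  then have "int d dvd c" using d prime_dvd_power[of "int d"] by simp
  have "int d ^ Suc e dvd coeff F j * c ^ j" if "j \<ge> 1" for j
  proof -
    obtain k where k: "n * e \<le> n * k + e * j" "int d ^ k dvd coeff F j"
      using ge unfolding newton_ge_def by blast
    have "e * j < n * j" using \<open>e < n\<close> that by simp
    then have "n * e < n * (k + j)" using k(1) unfolding distrib_left by linarith
    then have "Suc e \<le> k + j" by simp
    then have "int d ^ Suc e dvd int d ^ (k + j)" by (rule le_imp_power_dvd)
    also have "int d ^ (k + j) dvd coeff F j * c ^ j"
      unfolding power_add using k(2) \<open>int d dvd c\<close> by (intro mult_dvd_mono dvd_power_same)
    finally show ?thesis .
  qed
  then have "int d ^ Suc e dvd (\<Sum>j = 1..degree F. coeff F j * c ^ j)"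
    by (intro dvd_sum) auto
  moreover have "poly F c = coeff F 0 + (\<Sum>j = 1..degree F. coeff F j * c ^ j)"
    unfolding poly_altdef by (subst atMost_atLeast0, subst sum.atLeast_Suc_atMost) auto
  ultimately have "int d ^ Suc e dvd coeff F 0"
    using root by (metis dvd_add_left_iff dvd_0_right)
  moreover have "\<not> int d ^ Suc e dvd coeff F 0"
    using F0 d by (metis Suc_n_not_le_n not_prime_unit power_dvd_iff_le_multiplicity prime_nat_int_transfer)
  ultimately show False by contradiction
qed

subsection \<open>Degrees and rational roots\<close>

lemma orbit_2:
  "orbit_p d 2 = smult (int d ^ (d - 1)) (indet ^ 2)"
  "orbit_q d 2 = indet ^ d + [:(int d - 1) * int d ^ d:]"
  by (simp_all add: numeral_2_eq_2 of_nat_poly poly_const_pow one_pCons power2_eq_square)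

lemma indet_diff: "indet - of_nat d + 1 = [:1 - int d, 1:]"
  by (simp add: of_nat_poly one_pCons)

lemma degree_delta_1:
  assumes "d \<ge> 2"
  shows "degree (delta d 1) = d"
proof -
  have "delta d 1 = indet ^ d + - ([:1 - int d, 1:] * of_nat d ^ d)"
    unfolding delta_def indet_diff by simp
  moreover have "degree (- ([:1 - int d, 1:] * of_nat d ^ d)) \<le> 1"
    by (simp add: of_nat_poly poly_const_pow)
  ultimately show ?thesis
    using assms by (simp add: degree_add_eq_left degree_power_eq)
qed

lemma degree_orbit_q_2:
  assumes "d \<ge> 1"
  shows "degree (orbit_q d 2) = d" "lead_coeff (orbit_q d 2) = 1"
proof -
  show deg: "degree (orbit_q d 2) = d"
    using assms unfolding orbit_2 by (subst degree_add_eq_left) (simp_all add: degree_power_eq)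
  show "lead_coeff (orbit_q d 2) = 1"
    unfolding deg using assms unfolding orbit_2
    by (cases d) (simp_all add: degree_power_eq coeff_pCons flip: monom_altdef[of 1, unfolded smult_1_left] power_Suc)
qed

lemma degree_delta_2:
  assumes "d \<ge> 3"
  shows "degree (delta d 2) = d ^ 2 + 1" "lead_coeff (delta d 2) = -1"
proof -
  let ?B = "[:1 - int d, 1:] * orbit_q d 2 ^ d"
  have q: "orbit_q d 2 \<noteq> 0" using degree_orbit_q_2(1)[of d] assms by force
  have eq: "delta d 2 = - ?B + orbit_p d 2 ^ d" unfolding delta_def indet_diff by simp
  have B: "degree (- ?B) = d ^ 2 + 1"
    unfolding degree_minus using q assms
    by (subst degree_mult_eq) (simp_all add: degree_power_eq degree_orbit_q_2 power2_eq_square)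
  have "degree (orbit_p d 2 ^ d) \<le> 2 * d"
    using assms unfolding orbit_2 by (simp add: degree_power_eq)
  also have "2 * d \<le> d * d" using assms by (intro mult_le_mono1) simp
  also have "\<dots> < d ^ 2 + 1" by (simp add: power2_eq_square)
  finally have lt: "degree (orbit_p d 2 ^ d) < degree (- ?B)" unfolding B .
  show "degree (delta d 2) = d ^ 2 + 1" unfolding eq degree_add_eq_left[OF lt] B ..
  have "lead_coeff (delta d 2) = lead_coeff (- ?B)" unfolding eq using lt by (metis add.commute lead_coeff_add_le)
  also have "lead_coeff (orbit_q d 2) = 1" using assms by (intro degree_orbit_q_2) simp
  then have "lead_coeff (- ?B) = -1"
    unfolding lead_coeff_minus lead_coeff_mult lead_coeff_power by simp
  finally show "lead_coeff (delta d 2) = -1" .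
qed

text \<open>An upper bound suffices, since the Newton polygon supplies the matching lower bound for
  the degree of \<open>misiurewicz d 3\<close>.\<close>

lemma degree_delta_3:
  assumes "d \<ge> 3"
  shows "degree (delta d 3) \<le> d ^ 3 + 1"
proof -
  have q2: "degree (orbit_q d 2 ^ j) \<le> d * j" for j
    using degree_power_le[of "orbit_q d 2" j] degree_orbit_q_2(1)[of d] assms by simp
  have p2: "degree (orbit_p d 2) = 2"
    using assms unfolding orbit_2 by (simp add: degree_power_eq)
  have "orbit_p d 3 = indet * orbit_p d 2 * orbit_q d 2 ^ (d - 1)"
    by (simp only: numeral_3_eq_3 numeral_2_eq_2 orbit_p.simps)
  then have "degree (orbit_p d 3) \<le> 1 + 2 + d * (d - 1)"
    using degree_mult_le[of "indet * orbit_p d 2" "orbit_q d 2 ^ (d - 1)"]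
      degree_mult_le[of indet "orbit_p d 2"] q2[of "d - 1"] p2 by simp
  then have "degree (orbit_p d 3 ^ d) \<le> (1 + 2 + d * (d - 1)) * d"
    by (meson degree_power_le le_trans mult_le_mono1)
  also have "\<dots> \<le> d ^ 3 + 1"
  proof -
    have "(1 + 2 + d * (d - 1)) * d + d ^ 2 = d ^ 3 + 3 * d"
      using assms by (cases d) (simp_all add: power2_eq_square power3_eq_cube algebra_simps)
    moreover have "3 * d \<le> d ^ 2" using assms by (simp add: power2_eq_square)
    ultimately show ?thesis by linarith
  qed
  finally have A: "degree (orbit_p d 3 ^ d) \<le> d ^ 3 + 1" .
  have "orbit_q d 3 = orbit_p d 2 ^ d + (of_nat d - 1) * orbit_q d 2 ^ d"
    by (simp only: numeral_3_eq_3 numeral_2_eq_2 orbit_q.simps)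
  moreover have "degree (orbit_p d 2 ^ d) \<le> d ^ 2"
    using degree_power_le[of "orbit_p d 2" d] assms p2
    by (intro le_trans[OF degree_power_le]) (simp add: power2_eq_square)
  moreover have "degree ((of_nat d - 1) * orbit_q d 2 ^ d) \<le> d ^ 2"
    using degree_mult_le[of "of_nat d - 1" "orbit_q d 2 ^ d"] q2[of d]
    by (simp add: of_nat_poly one_pCons power2_eq_square)
  ultimately have "degree (orbit_q d 3) \<le> d ^ 2" by (simp add: degree_add_le)
  then have "degree (orbit_q d 3 ^ d) \<le> d ^ 2 * d"
    by (meson degree_power_le le_trans mult_le_mono1)
  then have "degree ([:1 - int d, 1:] * orbit_q d 3 ^ d) \<le> d ^ 3 + 1"
    using degree_mult_le[of "[:1 - int d, 1:]" "orbit_q d 3 ^ d"]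
    by (simp add: power2_eq_square power3_eq_cube)
  with A show ?thesis unfolding delta_def indet_diff by (intro degree_diff_le)
qed

lemma degree_delta_Suc:
  assumes "d \<ge> 2"
  shows "degree (delta d (Suc m)) = 1 + degree (misiurewicz d (Suc m)) + degree (delta d m)"
proof -
  have eq: "delta d (Suc m) = [:- int d, 1:] * misiurewicz d (Suc m) * delta d m"
    using delta_Suc[of d m] assms by (simp add: of_nat_poly)
  moreover have "delta d (Suc m) \<noteq> 0" by (rule delta_Suc_nonzero[OF assms])
  ultimately have "misiurewicz d (Suc m) \<noteq> 0" "delta d m \<noteq> 0" by auto
  then show ?thesis unfolding eq by (simp add: degree_mult_eq del: mult_pCons_left)
qed

lemma degree_misiurewicz:
  assumes "d \<ge> 3"
  shows "degree (misiurewicz d 1) = d - 2" "degree (misiurewicz d 2) = d ^ 2 - d"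
    "degree (misiurewicz d 3) \<le> d ^ 3 - d ^ 2 - 1"
proof -
  have "degree (delta d 0) = 1" by (simp add: delta_def of_nat_poly)
  then show "degree (misiurewicz d 1) = d - 2"
    using degree_delta_Suc[of d 0] degree_delta_1[of d] assms by simp
  show "degree (misiurewicz d 2) = d ^ 2 - d"
    using degree_delta_Suc[of d 1] degree_delta_1[of d] degree_delta_2[of d] assms
    by (simp add: numeral_2_eq_2)
  show "degree (misiurewicz d 3) \<le> d ^ 3 - d ^ 2 - 1"
    using degree_delta_Suc[of d 2] degree_delta_2(1)[of d] degree_delta_3[of d] assms
    by (simp add: numeral_3_eq_3 numeral_2_eq_2)
qed

section \<open>Rational roots of the second Misiurewicz polynomial\<close>

lemma poly_map_poly_of_int: "poly (map_poly of_int f) (of_int x) = (of_int (poly f x) :: rat)"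
  by (induction f) (simp_all add: map_poly_pCons)

text \<open>
  The power of \<open>d\<close> on the left must divide \<open>s + 1 - d\<close>, while \<open>s\<close> divides \<open>(d - 1) ^ (d + 1)\<close>; the sizes contradict.
\<close>

lemma delta_2_no_root_coprime:
  assumes "prime d" "d \<ge> 3" and "\<not> int d dvd s"
  shows "(s ^ 2 * int d ^ (d - 1)) ^ d \<noteq> (s + 1 - int d) * (s ^ d + (int d - 1) * int d ^ d) ^ d"
proof
  assume eq: "(s ^ 2 * int d ^ (d - 1)) ^ d = (s + 1 - int d) * (s ^ d + (int d - 1) * int d ^ d) ^ d"
  let ?q = "s ^ d + (int d - 1) * int d ^ d"
  have "coprime (int d) s" using assms by (simp add: prime_imp_coprime)
  have dvd_q: "int d dvd (int d - 1) * int d ^ d" using assms(2) by simp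
  have "\<not> int d dvd s ^ d" using assms prime_dvd_power[of "int d" s d] by auto
  then have "\<not> int d dvd ?q" using dvd_add_left_iff[OF dvd_q] by simp
  then have "coprime (int d) ?q" using assms(1) by (simp add: prime_imp_coprime)
  then have "coprime (int d ^ ((d - 1) * d)) (?q ^ d)" by simp
  moreover have "int d ^ ((d - 1) * d) dvd (s + 1 - int d) * ?q ^ d"
    unfolding eq[symmetric] by (simp add: power_mult_distrib power_mult)
  ultimately have d_dvd: "int d ^ ((d - 1) * d) dvd s + 1 - int d"
    by (simp only: coprime_dvd_mult_left_iff)
  have "s dvd s ^ d" using assms(2) by (intro dvd_power) simp
  have "s + 1 - int d \<noteq> 0"
  proof
    assume "s + 1 - int d = 0"
    then have "(s ^ 2 * int d ^ (d - 1)) ^ d = 0" unfolding eq by simp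
    then show False using assms by auto
  qed
  then have lower: "int d ^ ((d - 1) * d) \<le> \<bar>s + 1 - int d\<bar>"
    using dvd_imp_le_int[OF _ d_dvd] by simp
  have "s dvd (s ^ 2 * int d ^ (d - 1)) ^ d"
    using assms(2) by (intro dvd_trans[OF _ dvd_power]) (auto simp: power2_eq_square)
  \<comment> \<open>Reduction modulo \<open>s\<close>: the linear factor becomes
    \<open>1 - d\<close> and \<open>?q\<close> becomes \<open>(d - 1) * d ^ d\<close>.\<close>
  moreover have "s dvd (s + 1 - int d) * ?q ^ d - (1 - int d) * ((int d - 1) * int d ^ d) ^ d"
  proof -
    have "s dvd ?q ^ d - ((int d - 1) * int d ^ d) ^ d"
      using \<open>s dvd s ^ d\<close> by (intro dvd_diff_power) simp
    then have "s dvd s * ?q ^ d + (1 - int d) * (?q ^ d - ((int d - 1) * int d ^ d) ^ d)"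
      by (intro dvd_add[OF dvd_triv_left dvd_mult])
    then show ?thesis by (simp only: algebra_simps)
  qed
  ultimately have "s dvd (1 - int d) * ((int d - 1) * int d ^ d) ^ d"
    unfolding eq by (simp only: dvd_diff_right_iff)
  also have "(1 - int d) * ((int d - 1) * int d ^ d) ^ d = - ((int d - 1) ^ Suc d) * int d ^ (d * d)"
    unfolding power_mult_distrib power_mult power_Suc
    by (metis minus_diff_eq minus_mult_left mult.assoc)
  finally have "s dvd (int d - 1) ^ Suc d"
    using \<open>coprime (int d) s\<close>
    by (simp add: coprime_dvd_mult_left_iff coprime_commute del: power_Suc)
  then have "\<bar>s\<bar> \<le> (int d - 1) ^ Suc d"
    using dvd_imp_le_int[of "(int d - 1) ^ Suc d" s] assms(2) by (simp add: abs_mult power_abs)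
  also have "\<dots> \<le> int d ^ Suc d" using assms(2) by (intro power_mono) auto
  finally have "\<bar>s\<bar> \<le> int d ^ Suc d" .
  moreover have "int d ^ 1 \<le> int d ^ Suc d" using assms(2) by (intro power_increasing) auto
  then have "int d \<le> int d ^ Suc d" by (simp only: power_one_right)
  moreover have "int d ^ Suc d > 0" using assms(2) by simp
  \<comment> \<open>\<open>d \<ge> 3\<close> enters twice: one more factor d absorbs the 3, and
    \<open>d + 2 \<le> (d - 1) * d\<close>.\<close>
  ultimately have "\<bar>s + 1 - int d\<bar> < 3 * int d ^ Suc d" using assms(2) by linarith
  also have "\<dots> \<le> int d * int d ^ Suc d" using assms(2) by (intro mult_right_mono) auto
  also have "\<dots> = int d ^ (d + 2)" by simp
  also have "\<dots> \<le> int d ^ ((d - 1) * d)"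
  proof (intro power_increasing)
    have "2 * d \<le> (d - 1) * d" using assms(2) by (intro mult_le_mono1) simp
    then show "d + 2 \<le> (d - 1) * d" using assms(2) by linarith
  qed (use assms(2) in auto)
  finally show False using lower by simp
qed

lemma misiurewicz_2_no_rational_root:
  assumes d: "prime d" "d \<ge> 3"
  shows "poly (map_poly of_int (misiurewicz d 2)) (r :: rat) \<noteq> 0"
proof
  assume root: "poly (map_poly of_int (misiurewicz d 2)) r = 0"
  have delta_eq: "delta d 2 = (indet - of_nat d) * misiurewicz d 2 * delta d 1"
    using delta_Suc[of d 1] d by (simp add: numeral_2_eq_2)
  have "poly (map_poly of_int (- delta d 2)) r = 0"
    unfolding delta_eq mult_minus_right[symmetric]
    by (simp only: map_poly_of_int_mult poly_mult root mult_zero_left mult_zero_right)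
  \<comment> \<open>\<open>- delta d 2\<close> is monic with integer coefficients, so a rational
    root is an integer.\<close>
  moreover have "lead_coeff (- delta d 2) = 1" using degree_delta_2[OF d(2)] by simp
  ultimately have "algebraic_int r" unfolding algebraic_int_altdef_ipoly by blast
  then have "r \<in> \<int>" by (rule rational_algebraic_int_is_int) (metis Rats_of_rat of_rat_eq_id id_apply)
  then obtain s where r: "r = of_int s" by (elim Ints_cases)
  have s: "poly (misiurewicz d 2) s = 0" using root unfolding r poly_map_poly_of_int by simp
  show False
  proof (cases "int d dvd s")
    case False
    have "poly (delta d 2) s = 0" unfolding delta_eq by (simp add: s)
    then have "(s ^ 2 * int d ^ (d - 1)) ^ d = (s + 1 - int d) * (s ^ d + (int d - 1) * int d ^ d) ^ d"
      unfolding delta_def indet_diff orbit_2 by (simp add: mult.commute algebra_simps)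
    then show False using delta_2_no_root_coprime[OF d False] by contradiction
  next
    case True
    then obtain b where b: "s = int d * b" by (elim dvdE)
    define e n where "e = d ^ (2 - 1)" and "n = d ^ 2 - d ^ (2 - 1) - 1"
    obtain \<alpha> \<beta> F where F: "\<alpha> \<noteq> 0" "\<beta> \<noteq> 0"
      "smult \<alpha> (pcompose (misiurewicz d 2) [:int d, int d:]) = smult \<beta> F"
      "newton_ge (int d) n e (n * e) F" "of_nat d dvd F + [:0, 1:] ^ n"
      "coeff F 0 \<noteq> 0" "multiplicity (int d) (coeff F 0) = e"
      using newton_polygon_misiurewicz[OF d _ e_def n_def] by auto
    \<comment> \<open>In a = d (1 + c) the root \<open>s = d * b\<close> corresponds to
      \<open>c = b - 1\<close>.\<close>
    have "\<alpha> * poly (misiurewicz d 2) (int d + int d * (b - 1)) = \<beta> * poly F (b - 1)"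
      using arg_cong[OF F(3), of "\<lambda>f. poly f (b - 1)"] by (simp add: poly_pcompose mult.commute)
    then have "poly F (b - 1) = 0" using s F(2) by (simp add: b algebra_simps)
    moreover have "e < n"
    proof -
      have "d ^ 2 \<ge> 3 * d" using d(2) by (simp add: power2_eq_square)
      then show ?thesis using d(2) by (simp add: e_def n_def)
    qed
    ultimately show False using no_integer_root[OF d(1) F(4) _ F(5-7)] by blast
  qed
qed

theorem theorem1:
  fixes d m :: nat
  assumes "prime d" and "d \<ge> 3" and "m \<in> {1, 2, 3}"
  shows "irreducible (map_poly rat_of_int (misiurewicz d m))"
proof -
  let ?G = "map_poly rat_of_int (misiurewicz d m)"
  let ?n = "d ^ m - d ^ (m - 1) - 1"
  have deg: "1 \<le> degree ?G \<and> (degree ?G \<le> ?n \<or> m = 2 \<and> degree ?G = ?n + 1)"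
  proof -
    have "d ^ m = d * d ^ (m - 1)" using assms(3) by (cases m) auto
    moreover have "3 * d ^ (m - 1) \<le> d * d ^ (m - 1)" using assms(2) by (intro mult_le_mono1)
    moreover have "1 \<le> d ^ (m - 1)" using assms(2) by simp
    ultimately have "1 \<le> ?n" by linarith
    \<comment> \<open>The trivial factorization \<open>?G * 1\<close> turns the bound on factors
      into a lower bound for the degree.\<close>
    moreover have "?n \<le> degree ?G"
      using degree_factor_misiurewicz[OF assms(1,2), of m ?G 1] assms(3) \<open>1 \<le> ?n\<close> by auto
    moreover have "degree ?G \<le> ?n \<or> m = 2 \<and> degree ?G = ?n + 1"
      using assms(3) degree_misiurewicz[OF assms(2)] \<open>1 \<le> ?n\<close>
      by (auto simp: numeral_2_eq_2 numeral_3_eq_3)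
    ultimately show ?thesis by linarith
  qed
  have unit: "f dvd 1 \<longleftrightarrow> degree f = 0" if "f \<noteq> 0" for f :: "rat poly"
    using that by (simp add: is_unit_iff_degree)
  have "?G \<noteq> 0" using deg by (metis degree_0 not_one_le_zero)
  show ?thesis
  proof (rule irreducibleI)
    show "?G \<noteq> 0" by fact
    show "\<not> ?G dvd 1" using unit[OF \<open>?G \<noteq> 0\<close>] deg by simp
    fix g h assume gh: "?G = g * h"
    then have nz: "g \<noteq> 0" "h \<noteq> 0" using \<open>?G \<noteq> 0\<close> by auto
    have sum: "degree ?G = degree g + degree h" unfolding gh using nz by (rule degree_mult_eq)
    have no_linear: "degree f \<noteq> 1" if "f dvd ?G" "m = 2" for f
    proof
      assume "degree f = 1"
      then obtain a b where "f = [:a, b:]" "b \<noteq> 0"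
        by (metis One_nat_def degree_eq_zeroE degree_pCons_eq_if nat.inject one_neq_zero pCons_cases pCons_0_0 pCons_eq_0_iff)
      then have "poly f (- a / b) = 0" by simp
      then obtain r where "poly f r = 0" by blast
      then have "poly ?G r = 0" using that(1) by (auto elim: dvdE)
      then show False using misiurewicz_2_no_rational_root[OF assms(1,2)] that(2) by blast
    qed
    have "?n \<le> degree g \<or> ?n \<le> degree h"
      using assms by (intro degree_factor_misiurewicz[OF _ _ _ gh]) auto
    \<comment> \<open>Beside a factor of degree at least \<open>?n\<close> there is room for degree
      0, or for degree 1 when m = 2; a linear factor would give a rational root.\<close>
    then have "degree g = 0 \<or> degree h = 0"
      using deg sum no_linear[of g] no_linear[of h] gh by auto
    then show "g dvd 1 \<or> h dvd 1" using unit nz by blast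
  qed
qed

end
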